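(* Let $n\ge 1$ be an integer with $n\neq 1,3$. The Euclidean group $\mathrm{E}_n=\mathrm{O}_n\ltimes\mathbb{R}^n$ does not have compact quotients with a pseudo-Riemannian metric such that $\mathrm{E}_n$ acts isometrically and almost effectively. That is, there is no closed subgroup $H\subseteq\mathrm{E}_n$ such that $\mathrm{E}_n/H$ is compact, the action of $\mathrm{E}_n$ on $\mathrm{E}_n/H$ is almost effective, and $\mathrm{E}_n/H$ carries an $\mathrm{E}_n$-invariant pseudo-Riemannian metric.
   Context: $\mathrm{O}_n$ acts on $\mathbb{R}^n$ in the standard way. The action of a Lie group $G$ on a homogeneous space $M$ is almost effective if the stabilizer of any point does not contain a non-trivial connected normal subgroup of $G$. *)

theory Defs
  imports "HOL-Analysis.Analysis" "HOL-Algebra.Group_Action" "HOL-Algebra.Left_Coset"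
begin

section \<open>Smooth maps between subsets of Euclidean spaces\<close>

text \<open>For open \<open>S\<close>: \<open>f\<close> has continuous partial derivatives on \<open>S\<close> up to order \<open>k\<close>.\<close>

primrec Ck_on :: "nat \<Rightarrow> ('a::euclidean_space \<Rightarrow> 'b::euclidean_space) \<Rightarrow> 'a set \<Rightarrow> bool" where
  "Ck_on 0 f S \<longleftrightarrow> continuous_on S f"
| "Ck_on (Suc k) f S \<longleftrightarrow>
     (\<forall>x\<in>S. f differentiable (at x)) \<and>
     (\<forall>v. Ck_on k (\<lambda>x. frechet_derivative f (at x) v) S)"

text \<open>Smoothness on an arbitrary set means having local smooth extensions to open sets. On relatively
  open subsets of a linear subspace, or of an embedded submanifold, this is the intrinsic notion.\<close>

definition smooth_on :: "'a::euclidean_space set \<Rightarrow> ('a \<Rightarrow> 'b::euclidean_space) \<Rightarrow> bool" where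
  "smooth_on A f \<longleftrightarrow>
     (\<forall>x\<in>A. \<exists>W F. open W \<and> x \<in> W \<and> (\<forall>k. Ck_on k F W) \<and> (\<forall>y\<in>A \<inter> W. F y = f y))"

definition dir_deriv :: "('a::euclidean_space \<Rightarrow> 'b::euclidean_space) \<Rightarrow> 'a \<Rightarrow> 'a \<Rightarrow> 'b" where
  "dir_deriv f x u = vector_derivative (\<lambda>t. f (x + t *\<^sub>R u)) (at 0)"


section \<open>Smooth manifolds and pseudo-Riemannian metrics\<close>

text \<open>A chart is a pair \<open>(U, \<phi>)\<close> of a domain and a coordinate map. Charts take values in a linear
  subspace \<open>V\<close> of a Euclidean space instead of in a type \<open>real ^ 'd\<close>, so that the dimension
  \<open>dim V\<close> of the manifold (possibly \<open>0\<close>) can be quantified over inside a formula.\<close>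

type_synonym ('m, 'e) chart = "'m set \<times> ('m \<Rightarrow> 'e)"

definition smooth_atlas ::
  "'m topology \<Rightarrow> 'e::euclidean_space set \<Rightarrow> ('m, 'e) chart set \<Rightarrow> bool" where
  "smooth_atlas T V \<A> \<longleftrightarrow>
     subspace V \<and>
     (\<forall>(U, \<phi>)\<in>\<A>. openin T U \<and> openin (top_of_set V) (\<phi> ` U) \<and>
        homeomorphic_map (subtopology T U) (top_of_set (\<phi> ` U)) \<phi>) \<and>
     (\<Union>(U, \<phi>)\<in>\<A>. U) = topspace T \<and>
     (\<forall>(U, \<phi>)\<in>\<A>. \<forall>(W, \<psi>)\<in>\<A>. smooth_on (\<phi> ` (U \<inter> W)) (\<psi> \<circ> inv_into U \<phi>))"

definition smooth_manifold ::
  "'m topology \<Rightarrow> 'e::euclidean_space set \<Rightarrow> ('m, 'e) chart set \<Rightarrow> bool" where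
  "smooth_manifold T V \<A> \<longleftrightarrow> Hausdorff_space T \<and> second_countable T \<and> smooth_atlas T V \<A>"

definition smooth_self_map :: "('m, 'e::euclidean_space) chart set \<Rightarrow> ('m \<Rightarrow> 'm) \<Rightarrow> bool" where
  "smooth_self_map \<A> f \<longleftrightarrow>
     (\<forall>(U, \<phi>)\<in>\<A>. \<forall>(W, \<psi>)\<in>\<A>. smooth_on (\<phi> ` {p\<in>U. f p \<in> W}) (\<psi> \<circ> f \<circ> inv_into U \<phi>))"

definition diffeomorphism ::
  "'m topology \<Rightarrow> ('m, 'e::euclidean_space) chart set \<Rightarrow> ('m \<Rightarrow> 'm) \<Rightarrow> bool" where
  "diffeomorphism T \<A> f \<longleftrightarrow>
     homeomorphic_map T T f \<and> smooth_self_map \<A> f \<and> smooth_self_map \<A> (inv_into (topspace T) f)"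

text \<open>A tensor field of type \<open>(0,2)\<close> is given by its coordinate representations: \<open>g (U, \<phi>) x u w\<close> is
  the value, at the point with coordinates \<open>x\<close> in the chart \<open>(U, \<phi>)\<close>, on the tangent vectors with
  components \<open>u\<close> and \<open>w\<close> in that chart. The last clause is the tensor transformation law. The
  signature is arbitrary.\<close>

type_synonym ('m, 'e) metric_field = "('m, 'e) chart \<Rightarrow> 'e \<Rightarrow> 'e \<Rightarrow> 'e \<Rightarrow> real"

definition pseudo_euclidean_product ::
  "'e::euclidean_space set \<Rightarrow> ('e \<Rightarrow> 'e \<Rightarrow> real) \<Rightarrow> bool" where
  "pseudo_euclidean_product V b \<longleftrightarrow>
     (\<forall>u\<in>V. \<forall>w\<in>V. b u w = b w u) \<and>
     (\<forall>u\<in>V. \<forall>v\<in>V. \<forall>w\<in>V. b (u + v) w = b u w + b v w) \<and>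
     (\<forall>r. \<forall>u\<in>V. \<forall>w\<in>V. b (r *\<^sub>R u) w = r * b u w) \<and>
     (\<forall>u\<in>V. (\<forall>w\<in>V. b u w = 0) \<longrightarrow> u = 0)"

definition pseudo_riemannian_metric ::
  "'e::euclidean_space set \<Rightarrow> ('m, 'e) chart set \<Rightarrow> ('m, 'e) metric_field \<Rightarrow> bool" where
  "pseudo_riemannian_metric V \<A> g \<longleftrightarrow>
     (\<forall>(U, \<phi>)\<in>\<A>.
        (\<forall>p\<in>U. pseudo_euclidean_product V (g (U, \<phi>) (\<phi> p))) \<and>
        (\<forall>u\<in>V. \<forall>w\<in>V. smooth_on (\<phi> ` U) (\<lambda>x. g (U, \<phi>) x u w))) \<and>
     (\<forall>(U, \<phi>)\<in>\<A>. \<forall>(W, \<psi>)\<in>\<A>. \<forall>p\<in>U \<inter> W. \<forall>u\<in>V. \<forall>w\<in>V.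
        g (W, \<psi>) (\<psi> p) (dir_deriv (\<psi> \<circ> inv_into U \<phi>) (\<phi> p) u)
                      (dir_deriv (\<psi> \<circ> inv_into U \<phi>) (\<phi> p) w)
        = g (U, \<phi>) (\<phi> p) u w)"

definition isometry ::
  "'m topology \<Rightarrow> 'e::euclidean_space set \<Rightarrow> ('m, 'e) chart set \<Rightarrow> ('m, 'e) metric_field
     \<Rightarrow> ('m \<Rightarrow> 'm) \<Rightarrow> bool" where
  "isometry T V \<A> g f \<longleftrightarrow>
     diffeomorphism T \<A> f \<and>
     (\<forall>(U, \<phi>)\<in>\<A>. \<forall>(W, \<psi>)\<in>\<A>. \<forall>p\<in>U. f p \<in> W \<longrightarrow> (\<forall>u\<in>V. \<forall>w\<in>V.
        g (W, \<psi>) (\<psi> (f p)) (dir_deriv (\<psi> \<circ> f \<circ> inv_into U \<phi>) (\<phi> p) u)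
                          (dir_deriv (\<psi> \<circ> f \<circ> inv_into U \<phi>) (\<phi> p) w)
        = g (U, \<phi>) (\<phi> p) u w))"


section \<open>Homogeneous spaces\<close>

text \<open>Here \<open>G\<close> is a Lie group whose carrier is an embedded submanifold of a Euclidean space
  \<open>'a\<close>, with the subspace topology. The space \<open>G/H\<close> is the set of left cosets with the quotient
  topology; \<open>a\<close> in \<open>G\<close> acts on it by \<open>p \<mapsto> a <#\<^bsub>G\<^esub> p\<close>.\<close>

definition coset_topology :: "('a::euclidean_space, 'c) monoid_scheme \<Rightarrow> 'a set \<Rightarrow> 'a set topology"
  where "coset_topology G H = topology (\<lambda>U. U \<subseteq> lcosets\<^bsub>G\<^esub> H \<and>
           openin (top_of_set (carrier G)) {x \<in> carrier G. x <#\<^bsub>G\<^esub> H \<in> U})"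

lemma openin_coset_topology:
  "openin (coset_topology G H) U \<longleftrightarrow> U \<subseteq> lcosets\<^bsub>G\<^esub> H \<and>
     openin (top_of_set (carrier G)) {x \<in> carrier G. x <#\<^bsub>G\<^esub> H \<in> U}"
proof -
  let ?P = "\<lambda>U. {x \<in> carrier G. x <#\<^bsub>G\<^esub> H \<in> U}"
  have "istopology (\<lambda>U. U \<subseteq> lcosets\<^bsub>G\<^esub> H \<and> openin (top_of_set (carrier G)) (?P U))"
    unfolding istopology_def
  proof (intro conjI allI impI)
    fix S T
    assume "S \<subseteq> lcosets\<^bsub>G\<^esub> H \<and> openin (top_of_set (carrier G)) (?P S)"
      and "T \<subseteq> lcosets\<^bsub>G\<^esub> H \<and> openin (top_of_set (carrier G)) (?P T)"
    moreover have "?P (S \<inter> T) = ?P S \<inter> ?P T" by auto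
    ultimately show "S \<inter> T \<subseteq> lcosets\<^bsub>G\<^esub> H" "openin (top_of_set (carrier G)) (?P (S \<inter> T))"
      by (auto intro: openin_Int)
  next
    fix \<K>
    assume K: "\<forall>K\<in>\<K>. K \<subseteq> lcosets\<^bsub>G\<^esub> H \<and> openin (top_of_set (carrier G)) (?P K)"
    then show "\<Union>\<K> \<subseteq> lcosets\<^bsub>G\<^esub> H" by blast
    have "?P (\<Union>\<K>) = \<Union>(?P ` \<K>)" by auto
    then show "openin (top_of_set (carrier G)) (?P (\<Union>\<K>))"
      using K by (metis (no_types, lifting) imageE openin_Union)
  qed
  then show ?thesis
    by (simp add: coset_topology_def topology_inverse')
qed

lemma topspace_coset_topology: "topspace (coset_topology G H) = lcosets\<^bsub>G\<^esub> H"
proof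
  show "topspace (coset_topology G H) \<subseteq> lcosets\<^bsub>G\<^esub> H"
    using openin_coset_topology openin_topspace by blast
  have "{x \<in> carrier G. x <#\<^bsub>G\<^esub> H \<in> lcosets\<^bsub>G\<^esub> H} = carrier G"
    by (auto simp: LCOSETS_def)
  then have "openin (coset_topology G H) (lcosets\<^bsub>G\<^esub> H)"
    by (simp add: openin_coset_topology)
  then show "lcosets\<^bsub>G\<^esub> H \<subseteq> topspace (coset_topology G H)"
    by (rule openin_subset)
qed

definition almost_effective :: "('a::euclidean_space, 'c) monoid_scheme \<Rightarrow> 'a set \<Rightarrow> bool" where
  "almost_effective G H \<longleftrightarrow>
     (\<forall>p\<in>lcosets\<^bsub>G\<^esub> H. \<forall>N. N \<lhd> G \<and> connected N \<and> N \<subseteq> stabilizer G (\<lambda>a q. a <#\<^bsub>G\<^esub> q) p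
        \<longrightarrow> N = {\<one>\<^bsub>G\<^esub>})"

text \<open>The smooth structure of \<open>G/H\<close>, for closed \<open>H\<close>, is the unique one compatible with the quotient
  topology for which the projection \<open>x \<mapsto> x <#\<^bsub>G\<^esub> H\<close> is a smooth submersion. The
  second clause says that the differential of the projection at \<open>x\<close> is onto: each \<open>w\<close> in
  \<open>V\<close> is the image of the velocity of some smooth curve in \<open>G\<close> through \<open>x\<close>. Taking the
  model space \<open>V\<close> inside \<open>'a\<close> is no restriction, as \<open>G/H\<close> has at most the dimension of \<open>G\<close>.\<close>

definition projection_submersion ::
  "('a::euclidean_space, 'c) monoid_scheme \<Rightarrow> 'a set \<Rightarrow> 'a set \<Rightarrow> ('a set, 'a) chart set \<Rightarrow> bool"
  where
  "projection_submersion G H V \<A> \<longleftrightarrow>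
     (\<forall>(U, \<phi>)\<in>\<A>.
        smooth_on {x \<in> carrier G. x <#\<^bsub>G\<^esub> H \<in> U} (\<lambda>x. \<phi> (x <#\<^bsub>G\<^esub> H)) \<and>
        (\<forall>x\<in>carrier G. x <#\<^bsub>G\<^esub> H \<in> U \<longrightarrow> (\<forall>w\<in>V. \<exists>\<gamma>.
           smooth_on {-1<..<1::real} \<gamma> \<and> \<gamma> ` {-1<..<1} \<subseteq> carrier G \<and> \<gamma> 0 = x \<and>
           ((\<lambda>t. \<phi> (\<gamma> t <#\<^bsub>G\<^esub> H)) has_vector_derivative w) (at 0))))"

definition homogeneous_smooth_structure ::
  "('a::euclidean_space, 'c) monoid_scheme \<Rightarrow> 'a set \<Rightarrow> 'a set \<Rightarrow> ('a set, 'a) chart set \<Rightarrow> bool"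
  where
  "homogeneous_smooth_structure G H V \<A> \<longleftrightarrow>
     smooth_manifold (coset_topology G H) V \<A> \<and> projection_submersion G H V \<A>"

definition carries_invariant_pseudo_riemannian_metric ::
  "('a::euclidean_space, 'c) monoid_scheme \<Rightarrow> 'a set \<Rightarrow> bool" where
  "carries_invariant_pseudo_riemannian_metric G H \<longleftrightarrow>
     (\<exists>V \<A> g. homogeneous_smooth_structure G H V \<A> \<and> pseudo_riemannian_metric V \<A> g \<and>
        (\<forall>a\<in>carrier G. isometry (coset_topology G H) V \<A> g (\<lambda>p. a <#\<^bsub>G\<^esub> p)))"


section \<open>The Euclidean group\<close>

text \<open>The pair \<open>(A, v)\<close> stands for the motion \<open>x \<mapsto> A *v x + v\<close>.\<close>

definition euclidean_group :: "((real ^ 'n ^ 'n) \<times> (real ^ 'n)) monoid" where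
  "euclidean_group =
     \<lparr>carrier = {A. orthogonal_matrix A} \<times> UNIV,
      mult = (\<lambda>(A, v) (B, w). (A ** B, v + A *v w)),
      one = (mat 1, 0)\<rparr>"

lemma group_euclidean_group: "group (euclidean_group :: ((real ^ 'n ^ 'n) \<times> (real ^ 'n)) monoid)"
proof (rule groupI)
  fix x :: "(real ^ 'n ^ 'n) \<times> (real ^ 'n)"
  assume "x \<in> carrier euclidean_group"
  then obtain A v where x: "x = (A, v)" and A: "orthogonal_matrix A"
    by (auto simp: euclidean_group_def)
  have "(transpose A, - (transpose A *v v)) \<in> carrier euclidean_group"
    using A by (simp add: euclidean_group_def orthogonal_matrix_def)
  moreover have "(transpose A, - (transpose A *v v)) \<otimes>\<^bsub>euclidean_group\<^esub> x = \<one>\<^bsub>euclidean_group\<^esub>"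
    using A by (simp add: x euclidean_group_def orthogonal_matrix_def)
  ultimately show "\<exists>y\<in>carrier euclidean_group. y \<otimes>\<^bsub>euclidean_group\<^esub> x = \<one>\<^bsub>euclidean_group\<^esub>"
    by blast
qed (auto simp: euclidean_group_def orthogonal_matrix_mul orthogonal_matrix_id
       matrix_mul_assoc matrix_vector_mul_assoc matrix_vector_right_distrib add.assoc)

end

theory Submission
  imports Defs
begin

text \<open>Suppose \<open>M = G/H\<close> is compact and carries an invariant metric, where \<open>G = O\<^sub>n \<ltimes> \<real>\<^sup>n\<close>. Every
  element \<open>X\<close> of the Lie algebra generates a vector field on \<open>M\<close>, and at each point \<open>p\<close> of \<open>M\<close> the metric on
  these fields is a symmetric bilinear form \<open>\<beta>\<^sub>p\<close> on the Lie algebra. For fixed \<open>X\<close> and \<open>Y\<close>, the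
  function \<open>p \<mapsto> \<beta>\<^sub>p X Y\<close> is continuous on \<open>M\<close>, hence bounded (\<open>form_bounded\<close>).

  Let \<open>p\<close> run along the orbit of the translations \<open>t v\<close>. By invariance this has the effect of
  applying \<open>exp (t ad v)\<close>, up to sign, to \<open>X\<close> and \<open>Y\<close>. The square of \<open>ad v\<close> is zero, so the values
  of \<open>\<beta>\<close> are quadratic in \<open>t\<close>; being bounded, they are constant. Thus \<open>ad v\<close> is skew for every
  \<open>\<beta>\<^sub>p\<close> (\<open>form_translation_skew\<close>):
  \<open>\<beta> (A v) Y + \<beta> X (B v) = 0\<close> for \<open>X = (A, w)\<close> and \<open>Y = (B, u)\<close>.

  Inserting generators of plane rotations, elementary linear algebra shows that all of
  \<open>\<real>\<^sup>n\<close> lies in the kernel of \<open>\<beta>\<^sub>p\<close>, unless \<open>n\<close> is \<open>1\<close> or \<open>3\<close> (\<open>form_translation_eq_0\<close>). For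
  \<open>n = 1\<close> there are no rotations, and for \<open>n = 3\<close> the pairing of infinitesimal rotations
  with \<open>\<real>\<^sup>3\<close> through the cross product satisfies the skewness condition. The metric is nondegenerate
  and the fields span every tangent space, so the fields of translations vanish. Hence the translations fix
  the base point of \<open>M\<close>. They form a connected normal subgroup, against almost
  effectiveness.\<close>

section \<open>Curves in the Euclidean group\<close>

abbreviation eucl_mult (infixl \<open>\<cdot>\<close> 70) where
  "x \<cdot> y \<equiv> x \<otimes>\<^bsub>euclidean_group\<^esub> y"

lemma eucl_mult_eq: "x \<cdot> y = (fst x ** fst y, snd x + fst x *v snd y)"
  by (simp add: euclidean_group_def split_beta)

lemma eucl_mult_assoc: "(x \<cdot> y) \<cdot> z = x \<cdot> (y \<cdot> z)"
  by (simp add: eucl_mult_eq matrix_mul_assoc matrix_vector_mul_assoc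
      matrix_vector_right_distrib add.assoc)

lemma eucl_one_eq: "\<one>\<^bsub>euclidean_group\<^esub> = (mat 1, 0)"
  by (simp add: euclidean_group_def)

lemma eucl_carrier_iff: "x \<in> carrier euclidean_group \<longleftrightarrow> orthogonal_matrix (fst x)"
  by (simp add: euclidean_group_def mem_Times_iff)

lemma matrix_mult_add_right: "(A + A') ** B = A ** B + A' ** B"
  for A A' :: "real ^ 'n ^ 'm" and B :: "real ^ 'k ^ 'n"
  by (simp add: matrix_matrix_mult_def vec_eq_iff distrib_right sum.distrib)

text \<open>The group multiplication is a formula on the whole ambient vector space. As it is linear in the left
  factor, \<open>X \<cdot> x\<close> makes sense for a tangent vector \<open>X\<close> at the identity, and it is the value at \<open>x\<close>
  of the right-invariant vector field with generator \<open>X\<close>.\<close>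

lemma linear_eucl_mult_right: "linear (\<lambda>x. x \<cdot> y)"
  by (rule linearI)
    (simp_all add: eucl_mult_eq matrix_mult_add_right scalar_matrix_assoc scaleR_matrix_vector_assoc
      matrix_vector_mult_add_rdistrib scaleR_add_right)

lemma continuous_on_eucl_mult_left: "continuous_on S (\<lambda>y. x \<cdot> y)"
proof -
  have "linear (\<lambda>B. fst x ** B)"
    by (rule linearI) (simp_all add: matrix_add_ldistrib matrix_scalar_ac scalar_matrix_assoc)
  from linear_continuous_on_compose [OF continuous_on_fst [OF continuous_on_id] this]
  have "continuous_on S (\<lambda>y. fst x ** fst y)" .
  moreover from linear_continuous_on_compose [OF continuous_on_snd [OF continuous_on_id]
      matrix_vector_mul_linear]
  have "continuous_on S (\<lambda>y. fst x *v snd y)" .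
  ultimately show ?thesis
    unfolding eucl_mult_eq by (intro continuous_on_Pair continuous_on_add continuous_on_const)
qed

text \<open>Only the derivative at the base point matters below, so the curve need not be smooth, and it
  needs to stay in the group only near the parameter \<open>0\<close>.\<close>

definition group_curve ::
  "(real \<Rightarrow> (real ^ 'n ^ 'n) \<times> (real ^ 'n)) \<Rightarrow> (real ^ 'n ^ 'n) \<times> (real ^ 'n) \<Rightarrow>
     (real ^ 'n ^ 'n) \<times> (real ^ 'n) \<Rightarrow> bool" where
  "group_curve \<gamma> x \<xi> \<longleftrightarrow> \<gamma> 0 = x \<and> (\<forall>\<^sub>F t in nhds 0. \<gamma> t \<in> carrier euclidean_group) \<and>
     (\<gamma> has_vector_derivative \<xi>) (at 0)"

lemma group_curve_in_carrier: "group_curve \<gamma> x \<xi> \<Longrightarrow> x \<in> carrier euclidean_group"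
  unfolding group_curve_def using eventually_nhds_x_imp_x by auto

text \<open>Tangent vectors of curves at the identity. Describing this space by matrix equations is avoided:
  the argument gets by with translations, plane rotations, conjugation by translations, and right
  translation of velocities to the identity.\<close>

definition eucl_lie_algebra :: "((real ^ 'n ^ 'n) \<times> (real ^ 'n)) set" where
  "eucl_lie_algebra = {X. \<exists>c. group_curve c \<one>\<^bsub>euclidean_group\<^esub> X}"

lemma group_curve_mult_right:
  assumes "group_curve \<gamma> x \<xi>" "y \<in> carrier euclidean_group"
  shows "group_curve (\<lambda>t. \<gamma> t \<cdot> y) (x \<cdot> y) (\<xi> \<cdot> y)"
proof -
  interpret group "euclidean_group :: ((real ^ 'n ^ 'n) \<times> (real ^ 'n)) monoid"
    by (rule group_euclidean_group)
  have "((\<lambda>t. \<gamma> t \<cdot> y) has_vector_derivative \<xi> \<cdot> y) (at 0)"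
    using assms(1) linear_eucl_mult_right [of y]
      bounded_linear.has_vector_derivative [of "\<lambda>x. x \<cdot> y" \<gamma> \<xi> "at 0"]
    unfolding group_curve_def linear_conv_bounded_linear by blast
  moreover have "\<forall>\<^sub>F t in nhds 0. \<gamma> t \<cdot> y \<in> carrier euclidean_group"
    using assms unfolding group_curve_def by (auto elim!: eventually_mono)
  ultimately show ?thesis
    using assms unfolding group_curve_def by simp
qed

lemma translation_in_carrier: "(mat 1, v) \<in> carrier euclidean_group"
  by (simp add: eucl_carrier_iff orthogonal_matrix_id)

lemma translation_mult: "(mat 1, u) \<cdot> x = x + (0, u)"
  by (simp add: eucl_mult_eq prod_eq_iff)

text \<open>Left multiplication by a translation is a translation of the ambient vector space, so it
  leaves velocities unchanged.\<close>

lemma group_curve_translate: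
  assumes "group_curve \<gamma> x \<xi>"
  shows "group_curve (\<lambda>t. (mat 1, u) \<cdot> \<gamma> t) ((mat 1, u) \<cdot> x) \<xi>"
  using assms unfolding group_curve_def translation_mult
  by (auto simp: eucl_carrier_iff intro!: derivative_eq_intros elim!: eventually_mono)

lemma group_curve_translations:
  "group_curve (\<lambda>t. (mat 1, t *\<^sub>R v)) \<one>\<^bsub>euclidean_group\<^esub> (0, v)"
proof -
  have "((\<lambda>t. (mat 1, 0) + t *\<^sub>R (0, v)) has_vector_derivative (0, v)) (at 0)"
    by (auto intro!: derivative_eq_intros)
  then show ?thesis
    unfolding group_curve_def by (simp add: translation_in_carrier eucl_one_eq)
qed

lemma translation_in_lie_algebra: "(0, v) \<in> eucl_lie_algebra"
  unfolding eucl_lie_algebra_def using group_curve_translations by blast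

text \<open>With the translation \<open>a = (mat 1, - u)\<close>, the element \<open>X \<cdot> (mat 1, u)\<close> is \<open>Ad a X\<close>: left
  multiplication by \<open>a\<close> does not change velocities, so only the right factor of the conjugation is
  visible.\<close>

lemma conj_translation_in_lie_algebra:
  assumes "X \<in> eucl_lie_algebra"
  shows "X \<cdot> (mat 1, u) \<in> eucl_lie_algebra"
proof -
  obtain c where c: "group_curve c \<one>\<^bsub>euclidean_group\<^esub> X"
    using assms unfolding eucl_lie_algebra_def by blast
  have "group_curve (\<lambda>t. (mat 1, - u) \<cdot> (c t \<cdot> (mat 1, u)))
          ((mat 1, - u) \<cdot> (\<one>\<^bsub>euclidean_group\<^esub> \<cdot> (mat 1, u))) (X \<cdot> (mat 1, u))"
    by (intro group_curve_translate group_curve_mult_right c translation_in_carrier)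
  moreover have "(mat 1, - u) \<cdot> (\<one>\<^bsub>euclidean_group\<^esub> \<cdot> (mat 1, u)) = \<one>\<^bsub>euclidean_group\<^esub>"
    by (simp add: eucl_mult_eq eucl_one_eq)
  ultimately show ?thesis
    unfolding eucl_lie_algebra_def by auto
qed

lemma velocity_mult_inverse_in_lie_algebra:
  assumes "group_curve \<gamma> x \<xi>"
  obtains X where "X \<in> eucl_lie_algebra" "X \<cdot> x = \<xi>"
proof -
  interpret group "euclidean_group :: ((real ^ 'n ^ 'n) \<times> (real ^ 'n)) monoid"
    by (rule group_euclidean_group)
  let ?y = "inv\<^bsub>euclidean_group\<^esub> x"
  have x: "x \<in> carrier euclidean_group"
    using assms by (rule group_curve_in_carrier)
  have "group_curve (\<lambda>t. \<gamma> t \<cdot> ?y) (x \<cdot> ?y) (\<xi> \<cdot> ?y)"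
    using assms x by (intro group_curve_mult_right) simp_all
  then have "\<xi> \<cdot> ?y \<in> eucl_lie_algebra"
    using x unfolding eucl_lie_algebra_def by auto
  moreover have "\<xi> \<cdot> ?y \<cdot> x = \<xi>"
    using x by (simp add: eucl_mult_assoc) (simp add: eucl_mult_eq eucl_one_eq)
  ultimately show thesis by (rule that)
qed

text \<open>The matrix \<open>E\<close> with \<open>E e\<^sub>j = e\<^sub>i\<close>, \<open>E e\<^sub>i = - e\<^sub>j\<close> and \<open>E e\<^sub>k = 0\<close> for the other \<open>k\<close>.\<close>

definition rotation_generator :: "'n \<Rightarrow> 'n \<Rightarrow> real ^ 'n ^ 'n" where
  "rotation_generator i j = (\<chi> r. (axis i 1 $ r) *\<^sub>R axis j 1 - (axis j 1 $ r) *\<^sub>R axis i 1)"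

lemma rotation_generator_mult:
  "rotation_generator i j *v x = (x $ j) *\<^sub>R axis i 1 - (x $ i) *\<^sub>R axis j 1"
  by (simp add: vec_eq_iff matrix_vector_mul_component rotation_generator_def
      inner_diff_left inner_axis' mult.commute)

text \<open>As \<open>E\<^sup>3 = - E\<close>, the exponential series of \<open>E\<close> collapses to
  \<open>exp (t E) = 1 + sin t E + (1 - cos t) E\<^sup>2\<close>. This closed form serves as the curve, so that matrix
  exponentials are not needed.\<close>

lemma rotation_generator_in_lie_algebra:
  assumes "i \<noteq> j"
  shows "(rotation_generator i j, 0) \<in> eucl_lie_algebra"
proof -
  define E where "E = rotation_generator i j"
  define Q where "Q = E ** E"
  define R where "R t = mat 1 + sin t *\<^sub>R E + (1 - cos t) *\<^sub>R Q" for t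
  have neg: "(- A) *v x = - (A *v x)" for A :: "real ^ 'n ^ 'n" and x
    by (simp add: matrix_vector_mult_def vec_eq_iff sum_negf)
  have neg_right: "A *v (- x) = - (A *v x)" for A :: "real ^ 'n ^ 'n" and x
    by (simp add: matrix_vector_mult_def vec_eq_iff sum_negf)
  have E_mult: "E *v x = (x $ j) *\<^sub>R axis i 1 - (x $ i) *\<^sub>R axis j 1" for x
    by (simp add: E_def rotation_generator_mult)
  have "E *v (E *v (E *v x)) = - (E *v x)" for x
    using assms by (simp add: E_mult axis_def algebra_simps)
  then have EEE: "E ** (E ** E) = - E"
    by (simp add: matrix_eq matrix_vector_mul_assoc [symmetric] neg)
  then have QE: "Q ** E = - E" and EQ: "E ** Q = - E"
    by (simp_all add: Q_def matrix_mul_assoc)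
  have QQ: "Q ** Q = - Q"
    using QE neg by (metis Q_def matrix_mul_assoc matrix_eq matrix_vector_mul_assoc)
  have tE: "transpose E = - E"
    by (simp add: E_def rotation_generator_def transpose_def vec_eq_iff mult.commute)
  then have tQ: "transpose Q = Q"
    by (simp add: Q_def matrix_transpose_mul matrix_eq matrix_vector_mul_assoc [symmetric] neg neg_right
        del: transpose_matrix_vector)
  have tR: "transpose (R t) = mat 1 - sin t *\<^sub>R E + (1 - cos t) *\<^sub>R Q" for t
  proof -
    have "transpose (R t) = transpose (mat 1) + sin t *\<^sub>R transpose E + (1 - cos t) *\<^sub>R transpose Q"
      by (simp add: R_def transpose_def vec_eq_iff)
    then show ?thesis
      by (simp add: tE tQ)
  qed
  have "orthogonal_matrix (R t)" for t
  proof -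
    let ?s = "sin t" and ?c = "1 - cos t"
    have "(mat 1 - ?s *\<^sub>R E + ?c *\<^sub>R Q) ** R t *v x = x" for x
    proof -
      have 1: "E *v (E *v x) = Q *v x" "E *v (Q *v x) = - (E *v x)" "Q *v (E *v x) = - (E *v x)"
        "Q *v (Q *v x) = - (Q *v x)"
        by (simp_all only: matrix_vector_mul_assoc QE EQ QQ Q_def [symmetric])
           (simp_all only: neg)
      have "(mat 1 - a *\<^sub>R E + b *\<^sub>R Q) ** (mat 1 + a *\<^sub>R E + b *\<^sub>R Q) *v x =
         x + (b + b - a\<^sup>2 - b\<^sup>2) *\<^sub>R (Q *v x)" for a b
        by (simp add: matrix_vector_mul_assoc [symmetric] matrix_vector_mult_add_rdistrib
          matrix_vector_mult_diff_rdistrib scaleR_matrix_vector_assoc [symmetric]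
          matrix_vector_right_distrib matrix_vector_mult_scaleR 1)
           (simp add: vec_eq_iff algebra_simps power2_eq_square)
      moreover have "?c + ?c - ?s\<^sup>2 - ?c\<^sup>2 = 0"
        using sin_cos_squared_add [of t] by (simp add: power2_eq_square algebra_simps)
      ultimately show ?thesis
        unfolding R_def by (metis add.right_neutral scaleR_zero_left)
    qed
    then show ?thesis
      unfolding orthogonal_matrix tR matrix_eq by simp
  qed
  moreover have "R 0 = mat 1"
    by (simp add: R_def)
  moreover have "((\<lambda>t. (R t, 0)) has_vector_derivative (E, 0)) (at 0)"
  proof (rule has_vector_derivative_Pair)
    show "(R has_vector_derivative E) (at 0)"
      unfolding R_def has_vector_derivative_def
      by (rule derivative_eq_intros refl | simp)+
  qed simp
  ultimately have "group_curve (\<lambda>t. (R t, 0)) \<one>\<^bsub>euclidean_group\<^esub> (E, 0)"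
    by (simp add: group_curve_def eucl_carrier_iff eucl_one_eq)
  then show ?thesis
    unfolding eucl_lie_algebra_def E_def by blast
qed

section \<open>Derivatives of maps with smooth local extensions\<close>

lemma has_vector_derivative_transform_eventually:
  assumes "(f has_vector_derivative f') (at x)" "\<forall>\<^sub>F t in nhds x. f t = g t"
  shows "(g has_vector_derivative f') (at x)"
proof -
  obtain S where "open S" "x \<in> S" "\<And>t. t \<in> S \<Longrightarrow> f t = g t"
    using assms(2) unfolding eventually_nhds by blast
  with assms(1) show ?thesis
    by (rule has_vector_derivative_transform_within_open)
qed

lemma isCont_eventually_mem:
  assumes "isCont f x" "open S" "f x \<in> S"
  shows "\<forall>\<^sub>F y in nhds x. f y \<in> S"
  using assms unfolding continuous_at_open eventually_nhds by blast

lemma has_vector_derivative_in_subspace: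
  fixes f :: "real \<Rightarrow> 'b::euclidean_space"
  assumes "subspace V" "(f has_vector_derivative f') (at x)" "\<forall>\<^sub>F t in nhds x. f t \<in> V"
  shows "f' \<in> V"
proof (rule Lim_in_closed_set)
  show "closed V"
    using assms(1) by (rule closed_subspace)
  show "((\<lambda>h. (f (x + h) - f x) /\<^sub>R h) \<longlongrightarrow> f') (at 0)"
  proof -
    have "((\<lambda>h. norm (f (x + h) - f x - h *\<^sub>R f') / norm h) \<longlongrightarrow> 0) (at 0)"
      using assms(2) unfolding has_vector_derivative_def has_derivative_at by blast
    moreover have "\<forall>\<^sub>F h in at 0. norm (f (x + h) - f x - h *\<^sub>R f') / norm h
        = norm ((f (x + h) - f x) /\<^sub>R h - f')"
    proof (rule eventually_mono [OF eventually_neq_at_within [of 0]])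
      fix h :: real assume "h \<noteq> 0"
      then have "(f (x + h) - f x) /\<^sub>R h - f' = (f (x + h) - f x - h *\<^sub>R f') /\<^sub>R h"
        by (simp add: scaleR_diff_right)
      then show "norm (f (x + h) - f x - h *\<^sub>R f') / norm h
        = norm ((f (x + h) - f x) /\<^sub>R h - f')"
        by (simp add: divide_inverse mult.commute)
    qed
    ultimately have "((\<lambda>h. norm ((f (x + h) - f x) /\<^sub>R h - f')) \<longlongrightarrow> 0) (at 0)"
      by (rule Lim_transform_eventually)
    then show ?thesis
      by (simp add: LIM_zero_iff tendsto_norm_zero_iff)
  qed
  have "f x \<in> V"
    using assms(3) by (rule eventually_nhds_x_imp_x)
  have "((\<lambda>h. x + h) \<longlongrightarrow> x + 0) (at 0)"
    by (intro tendsto_intros)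
  then have "filterlim (\<lambda>h. x + h) (nhds x) (at 0)"
    by simp
  with assms(3) have "\<forall>\<^sub>F h in at 0. f (x + h) \<in> V"
    by (rule eventually_compose_filterlim)
  then show "\<forall>\<^sub>F h in at 0. (f (x + h) - f x) /\<^sub>R h \<in> V"
    by (rule eventually_mono) (simp add: subspace_scale subspace_diff assms(1) \<open>f x \<in> V\<close>)
qed simp

lemma smooth_on_extension:
  assumes "smooth_on A f" "x \<in> A"
  obtains W F where "open W" "x \<in> W" "\<And>y. y \<in> W \<Longrightarrow> F differentiable (at y)"
    "\<And>v. continuous_on W (\<lambda>y. frechet_derivative F (at y) v)"
    "\<And>y. y \<in> A \<Longrightarrow> y \<in> W \<Longrightarrow> F y = f y"
proof -
  obtain W F where W: "open W" "x \<in> W" "\<forall>k. Ck_on k F W" "\<forall>y\<in>A \<inter> W. F y = f y"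
    using assms unfolding smooth_on_def by blast
  from W(3) have "Ck_on (Suc 0) F W" by blast
  then have F: "\<forall>x\<in>W. F differentiable (at x)"
    "\<forall>v. continuous_on W (\<lambda>x. frechet_derivative F (at x) v)"
    by simp_all
  show thesis
    by (rule that [of W F]) (use W F in blast)+
qed

lemma continuous_on_local:
  fixes S :: "'a::t2_space set"
  assumes "\<And>x. x \<in> S \<Longrightarrow> \<exists>W. open W \<and> x \<in> W \<and> continuous_on (S \<inter> W) f"
  shows "continuous_on S f"
  unfolding continuous_on_eq_continuous_within
proof
  fix x assume x: "x \<in> S"
  then obtain W where W: "open W" "x \<in> W" "continuous_on (S \<inter> W) f"
    using assms by blast
  then have "continuous (at x within S \<inter> W) f"
    using x by (simp add: continuous_on_eq_continuous_within)
  moreover have "at x within S = at x within S \<inter> W"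
    using W(1,2) by (intro at_within_nhd [of x W]) auto
  ultimately show "continuous (at x within S) f"
    by simp
qed

lemma smooth_on_imp_continuous_on:
  assumes "smooth_on A f"
  shows "continuous_on A f"
  unfolding continuous_on_def
proof
  fix x assume x: "x \<in> A"
  obtain W F where W: "open W" "x \<in> W" "\<And>y. y \<in> W \<Longrightarrow> F differentiable (at y)"
    "\<And>y. y \<in> A \<Longrightarrow> y \<in> W \<Longrightarrow> F y = f y"
    using smooth_on_extension [OF assms x] by metis
  have "isCont F x"
    using W(2,3) differentiable_imp_continuous_within by blast
  then have "(F \<longlongrightarrow> f x) (at x within A)"
    using W x by (metis continuous_within continuous_at_imp_continuous_at_within)
  moreover have "\<forall>\<^sub>F y in at x within A. F y = f y"
    unfolding eventually_at_topological using W by blast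
  ultimately show "(f \<longlongrightarrow> f x) (at x within A)"
    by (rule Lim_transform_eventually)
qed

text \<open>The chain rule for a function \<open>f\<close> that is given only on a set \<open>A\<close> without interior, such as a
  submanifold or an open part of a subspace, through a local extension \<open>F\<close>. The outcome shows that
  the derivative of \<open>F\<close> is determined by \<open>f\<close> along directions tangent to \<open>A\<close>.\<close>

lemma has_vector_derivative_extension_compose:
  assumes "F differentiable (at x)" "open W" "x \<in> W" "\<And>y. y \<in> A \<Longrightarrow> y \<in> W \<Longrightarrow> F y = f y"
    and "\<gamma> s = x" "(\<gamma> has_vector_derivative \<xi>) (at s)" "\<forall>\<^sub>F t in nhds s. \<gamma> t \<in> A"
  shows "((\<lambda>t. f (\<gamma> t)) has_vector_derivative frechet_derivative F (at x) \<xi>) (at s)"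
proof (rule has_vector_derivative_transform_eventually)
  have "(F has_derivative frechet_derivative F (at x)) (at (\<gamma> s))"
    using assms(1,5) frechet_derivative_works by blast
  then have "((\<lambda>t. F (\<gamma> t)) has_derivative (\<lambda>h. frechet_derivative F (at x) (h *\<^sub>R \<xi>))) (at s)"
    using assms(6) unfolding has_vector_derivative_def by (rule has_derivative_compose [rotated])
  then show "((\<lambda>t. F (\<gamma> t)) has_vector_derivative frechet_derivative F (at x) \<xi>) (at s)"
    unfolding has_vector_derivative_def
    by (simp add: linear_frechet_derivative [OF assms(1)] linear_scale)
  have "continuous (at s) \<gamma>"
    using assms(6) by (rule has_vector_derivative_continuous)
  then have "\<forall>\<^sub>F t in nhds s. \<gamma> t \<in> W"
    by (rule isCont_eventually_mem) (use assms(2,3,5) in auto)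
  with assms(7) show "\<forall>\<^sub>F t in nhds s. F (\<gamma> t) = f (\<gamma> t)"
    by (rule eventually_elim2) (rule assms(4))
qed

section \<open>Velocity fields on the quotient\<close>

locale euclidean_quotient =
  fixes H :: "((real ^ 'n ^ 'n) \<times> (real ^ 'n)) set"
    and V :: "((real ^ 'n ^ 'n) \<times> (real ^ 'n)) set"
    and \<A> :: "(((real ^ 'n ^ 'n) \<times> (real ^ 'n)) set, (real ^ 'n ^ 'n) \<times> (real ^ 'n)) chart set"
  assumes subgroup_H: "subgroup H euclidean_group"
    and smooth_structure: "homogeneous_smooth_structure euclidean_group H V \<A>"
begin

sublocale eucl: group "euclidean_group :: ((real ^ 'n ^ 'n) \<times> (real ^ 'n)) monoid"
  by (rule group_euclidean_group)

abbreviation E where "E \<equiv> carrier (euclidean_group :: ((real ^ 'n ^ 'n) \<times> (real ^ 'n)) monoid)"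

abbreviation act (infixr \<open>\<star>\<close> 65) where "a \<star> p \<equiv> a <#\<^bsub>euclidean_group\<^esub> p"

abbreviation M where "M \<equiv> coset_topology euclidean_group H"

lemma act_coset: "a \<in> E \<Longrightarrow> x \<in> E \<Longrightarrow> a \<star> (x \<star> H) = (a \<cdot> x) \<star> H"
  by (rule eucl.lcos_m_assoc [OF subgroup.subset [OF subgroup_H]])

lemma in_topspace_iff: "p \<in> topspace M \<longleftrightarrow> (\<exists>x\<in>E. p = x \<star> H)"
  by (auto simp: topspace_coset_topology LCOSETS_def)

lemma openin_preimage: "openin M U \<Longrightarrow> openin (top_of_set E) {x \<in> E. x \<star> H \<in> U}"
  by (simp add: openin_coset_topology)

lemma subspace_V: "subspace V"
  using smooth_structure
  by (simp add: homogeneous_smooth_structure_def smooth_manifold_def smooth_atlas_def)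

lemma chart_cover:
  assumes "p \<in> topspace M"
  obtains U \<phi> where "(U, \<phi>) \<in> \<A>" "p \<in> U"
proof -
  have "(\<Union>(U, \<phi>)\<in>\<A>. U) = topspace M"
    using smooth_structure
    by (simp add: homogeneous_smooth_structure_def smooth_manifold_def smooth_atlas_def)
  with assms have "p \<in> (\<Union>(U, \<phi>)\<in>\<A>. U)" by simp
  then show thesis using that by blast
qed

lemma chart:
  assumes "(U, \<phi>) \<in> \<A>"
  shows chart_open: "openin M U"
    and chart_range_open: "openin (top_of_set V) (\<phi> ` U)"
    and chart_homeomorphic: "homeomorphic_map (subtopology M U) (top_of_set (\<phi> ` U)) \<phi>"
    and chart_inj: "inj_on \<phi> U"
    and chart_smooth: "smooth_on {x \<in> E. x \<star> H \<in> U} (\<lambda>x. \<phi> (x \<star> H))"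
proof -
  show U: "openin M U"
    and "openin (top_of_set V) (\<phi> ` U)"
    and h: "homeomorphic_map (subtopology M U) (top_of_set (\<phi> ` U)) \<phi>"
    using smooth_structure assms
    by (auto simp: homogeneous_smooth_structure_def smooth_manifold_def smooth_atlas_def)
  have "topspace (subtopology M U) = U"
    using openin_subset [OF U] by auto
  then show "inj_on \<phi> U"
    using h by (metis homeomorphic_imp_injective_map)
  show "smooth_on {x \<in> E. x \<star> H \<in> U} (\<lambda>x. \<phi> (x \<star> H))"
    using smooth_structure assms
    by (auto simp: homogeneous_smooth_structure_def projection_submersion_def)
qed

lemma openin_chart_image:
  assumes "(U, \<phi>) \<in> \<A>" "openin M S" "S \<subseteq> U"
  shows "openin (top_of_set V) (\<phi> ` S)"
proof -
  have "openin (subtopology M U) S"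
    using assms(2,3) by (simp add: openin_subtopology_Int2 openin_subtopology subset_eq Int_absorb2) blast
  then have "openin (top_of_set (\<phi> ` U)) (\<phi> ` S)"
    using chart_homeomorphic [OF assms(1)]
    by (meson homeomorphic_imp_open_map open_map_def)
  then show ?thesis
    using chart_range_open [OF assms(1)] openin_trans by blast
qed

lemma group_curve_eventually:
  assumes "group_curve \<gamma> x \<xi>" "openin (top_of_set E) S" "x \<in> S"
  shows "\<forall>\<^sub>F t in nhds 0. \<gamma> t \<in> S"
proof -
  obtain O' where O: "open O'" "S = E \<inter> O'"
    using assms(2) by (auto simp: openin_open)
  have "isCont \<gamma> 0" "\<forall>\<^sub>F t in nhds 0. \<gamma> t \<in> E" "\<gamma> 0 = x"
    using assms(1) has_vector_derivative_continuous unfolding group_curve_def by blast+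
  moreover from this(1) have "\<forall>\<^sub>F t in nhds 0. \<gamma> t \<in> O'"
    by (rule isCont_eventually_mem) (use O assms(3) calculation(3) in auto)
  ultimately show ?thesis
    unfolding O(2) by (auto elim: eventually_elim2)
qed

text \<open>In a chart, the projection to the quotient has near each point a differential \<open>D y\<close> that is linear
  and depends continuously on \<open>y\<close>. It comes from a smooth extension to the ambient space; on vectors
  not tangent to the group its values depend on the extension.\<close>

lemma projection_differential:
  assumes "(U, \<phi>) \<in> \<A>" "x \<in> E" "x \<star> H \<in> U"
  obtains W D where "open W" "x \<in> W" "\<And>y. y \<in> W \<Longrightarrow> linear (D y)"
    "\<And>\<xi>. continuous_on W (\<lambda>y. D y \<xi>)"
    "\<And>y \<gamma> \<xi>. y \<in> W \<Longrightarrow> y \<star> H \<in> U \<Longrightarrow> group_curve \<gamma> y \<xi> \<Longrightarrow>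
       ((\<lambda>t. \<phi> (\<gamma> t \<star> H)) has_vector_derivative D y \<xi>) (at 0)"
proof -
  let ?S = "{x \<in> E. x \<star> H \<in> U}"
  obtain W F where W: "open W" "x \<in> W" "\<And>y. y \<in> W \<Longrightarrow> F differentiable (at y)"
    "\<And>v. continuous_on W (\<lambda>y. frechet_derivative F (at y) v)"
    "\<And>y. y \<in> ?S \<Longrightarrow> y \<in> W \<Longrightarrow> F y = \<phi> (y \<star> H)"
    by (rule smooth_on_extension [OF chart_smooth [OF assms(1)], of x]) (use assms in blast)+
  show thesis
  proof (rule that [of W "\<lambda>y. frechet_derivative F (at y)"])
    fix y \<gamma> \<xi>
    assume y: "y \<in> W" "y \<star> H \<in> U" and \<gamma>: "group_curve \<gamma> y \<xi>"
    have "\<forall>\<^sub>F t in nhds 0. \<gamma> t \<in> ?S"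
      using \<gamma> y by (intro group_curve_eventually [OF \<gamma>] openin_preimage chart_open [OF assms(1)])
        (simp add: group_curve_in_carrier)
    then show "((\<lambda>t. \<phi> (\<gamma> t \<star> H)) has_vector_derivative frechet_derivative F (at y) \<xi>) (at 0)"
      using \<gamma> unfolding group_curve_def
      by (intro has_vector_derivative_extension_compose [where A = ?S, OF W(3) [OF y(1)] W(1) y(1) W(5)])
        simp_all
  qed (use W linear_frechet_derivative in blast)+
qed

text \<open>The fundamental vector field of \<open>X\<close> at the coset \<open>p\<close>, read in the chart \<open>\<phi>\<close>. Defining it on cosets
  rather than on group elements makes the invariant form below a function on the compact quotient.
  The choice of the curve is immaterial by \<open>velocity_curve\<close>.\<close>

definition velocity where
  "velocity \<phi> p X = vector_derivative
     (\<lambda>t. \<phi> ((SOME c. group_curve c \<one>\<^bsub>euclidean_group\<^esub> X) t \<star> p)) (at 0)"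

lemma velocity_differential:
  assumes "(U, \<phi>) \<in> \<A>" "x \<in> E" "x \<star> H \<in> U"
  obtains W D where "open W" "x \<in> W" "\<And>y. y \<in> W \<Longrightarrow> linear (D y)"
    "\<And>\<xi>. continuous_on W (\<lambda>y. D y \<xi>)"
    "\<And>y \<gamma> \<xi>. y \<in> W \<Longrightarrow> y \<star> H \<in> U \<Longrightarrow> group_curve \<gamma> y \<xi> \<Longrightarrow>
       ((\<lambda>t. \<phi> (\<gamma> t \<star> H)) has_vector_derivative D y \<xi>) (at 0)"
    "\<And>y X. y \<in> W \<Longrightarrow> y \<in> E \<Longrightarrow> y \<star> H \<in> U \<Longrightarrow> X \<in> eucl_lie_algebra \<Longrightarrow>
       velocity \<phi> (y \<star> H) X = D y (X \<cdot> y)"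
proof -
  obtain W D where D: "open W" "x \<in> W" "\<And>y. y \<in> W \<Longrightarrow> linear (D y)"
    "\<And>\<xi>. continuous_on W (\<lambda>y. D y \<xi>)"
    "\<And>y \<gamma> \<xi>. y \<in> W \<Longrightarrow> y \<star> H \<in> U \<Longrightarrow> group_curve \<gamma> y \<xi> \<Longrightarrow>
       ((\<lambda>t. \<phi> (\<gamma> t \<star> H)) has_vector_derivative D y \<xi>) (at 0)"
    using projection_differential [OF assms] by metis
  have "velocity \<phi> (y \<star> H) X = D y (X \<cdot> y)"
    if y: "y \<in> W" "y \<in> E" "y \<star> H \<in> U" and X: "X \<in> eucl_lie_algebra" for y X
  proof -
    let ?c = "SOME c. group_curve c \<one>\<^bsub>euclidean_group\<^esub> X"
    have c: "group_curve ?c \<one>\<^bsub>euclidean_group\<^esub> X"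
      using X unfolding eucl_lie_algebra_def mem_Collect_eq by (rule someI_ex)
    have cy: "group_curve (\<lambda>t. ?c t \<cdot> y) y (X \<cdot> y)"
      using group_curve_mult_right [OF c y(2)] y(2) by simp
    have "\<forall>\<^sub>F t in nhds 0. ?c t \<in> E"
      using c unfolding group_curve_def by blast
    then have "\<forall>\<^sub>F t in nhds 0. \<phi> ((?c t \<cdot> y) \<star> H) = \<phi> (?c t \<star> (y \<star> H))"
      by (rule eventually_mono) (simp add: act_coset y(2))
    from has_vector_derivative_transform_eventually [OF D(5) [OF y(1,3) cy] this]
    show ?thesis
      unfolding velocity_def by (rule vector_derivative_at)
  qed
  with D show thesis by (intro that [of W D])
qed

lemma velocity_curve:
  assumes "(U, \<phi>) \<in> \<A>" "x \<star> H \<in> U" "X \<in> eucl_lie_algebra" "group_curve \<gamma> x (X \<cdot> x)"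
  shows "((\<lambda>t. \<phi> (\<gamma> t \<star> H)) has_vector_derivative velocity \<phi> (x \<star> H) X) (at 0)"
proof -
  have x: "x \<in> E"
    using assms(4) by (rule group_curve_in_carrier)
  show ?thesis
    by (rule velocity_differential [OF assms(1) x assms(2)]) (use assms x in simp)
qed

lemma velocity_curve_exists:
  assumes "x \<in> E" "X \<in> eucl_lie_algebra"
  obtains \<gamma> where "group_curve \<gamma> x (X \<cdot> x)"
proof -
  obtain c where "group_curve c \<one>\<^bsub>euclidean_group\<^esub> X"
    using assms(2) unfolding eucl_lie_algebra_def by blast
  from group_curve_mult_right [OF this assms(1)] that show thesis
    using assms(1) by simp
qed

lemma velocity_in_V:
  assumes "(U, \<phi>) \<in> \<A>" "x \<in> E" "x \<star> H \<in> U" "X \<in> eucl_lie_algebra"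
  shows "velocity \<phi> (x \<star> H) X \<in> V"
proof -
  obtain \<gamma> where \<gamma>: "group_curve \<gamma> x (X \<cdot> x)"
    using assms(2,4) by (rule velocity_curve_exists)
  have "\<forall>\<^sub>F t in nhds 0. \<gamma> t \<in> {x \<in> E. x \<star> H \<in> U}"
    using assms by (intro group_curve_eventually [OF \<gamma>] openin_preimage chart_open [OF assms(1)]) simp
  then have "\<forall>\<^sub>F t in nhds 0. \<phi> (\<gamma> t \<star> H) \<in> V"
    by (rule eventually_mono) (use openin_imp_subset [OF chart_range_open [OF assms(1)]] in blast)
  with subspace_V velocity_curve [OF assms(1,3,4) \<gamma>] show ?thesis
    by (rule has_vector_derivative_in_subspace)
qed

lemma velocity_add_scaleR:
  assumes "(U, \<phi>) \<in> \<A>" "x \<in> E" "x \<star> H \<in> U"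
    and "X \<in> eucl_lie_algebra" "Y \<in> eucl_lie_algebra" "X + r *\<^sub>R Y \<in> eucl_lie_algebra"
  shows "velocity \<phi> (x \<star> H) (X + r *\<^sub>R Y) = velocity \<phi> (x \<star> H) X + r *\<^sub>R velocity \<phi> (x \<star> H) Y"
proof -
  have "(X + r *\<^sub>R Y) \<cdot> x = X \<cdot> x + r *\<^sub>R (Y \<cdot> x)"
    by (simp add: linear_add [OF linear_eucl_mult_right] linear_scale [OF linear_eucl_mult_right])
  moreover obtain D where "linear (D x)"
    "\<And>X. X \<in> eucl_lie_algebra \<Longrightarrow> velocity \<phi> (x \<star> H) X = D x (X \<cdot> x)"
    by (rule velocity_differential [OF assms(1-3)]) (use assms(2,3) in blast)
  ultimately show ?thesis
    using assms(4-6) by (simp add: linear_add linear_scale)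
qed

text \<open>The projection is a submersion, and right translation moves the velocity of any curve through \<open>x\<close>
  to the identity.\<close>

lemma velocity_onto:
  assumes "(U, \<phi>) \<in> \<A>" "x \<in> E" "x \<star> H \<in> U" "w \<in> V"
  obtains X where "X \<in> eucl_lie_algebra" "velocity \<phi> (x \<star> H) X = w"
proof -
  obtain \<gamma> where \<gamma>: "smooth_on {-1<..<1::real} \<gamma>" "\<gamma> ` {-1<..<1} \<subseteq> E" "\<gamma> 0 = x"
    "((\<lambda>t. \<phi> (\<gamma> t \<star> H)) has_vector_derivative w) (at 0)"
    using smooth_structure assms
    unfolding homogeneous_smooth_structure_def projection_submersion_def by blast
  have ev: "\<forall>\<^sub>F t in nhds 0. t \<in> {-1<..<1::real}"
    by (rule eventually_nhds_in_open) auto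
  obtain W F where W: "open W" "(0::real) \<in> W" "\<And>y. y \<in> W \<Longrightarrow> F differentiable (at y)"
    "\<And>y. y \<in> {-1<..<1} \<Longrightarrow> y \<in> W \<Longrightarrow> F y = \<gamma> y"
    by (rule smooth_on_extension [OF \<gamma>(1), of 0]) auto
  have "((\<lambda>t. \<gamma> t) has_vector_derivative frechet_derivative F (at 0) 1) (at 0)"
    using W ev by (intro has_vector_derivative_extension_compose
      [where A = "{-1<..<1}" and W = W and \<gamma> = "\<lambda>t. t" and x = 0 and s = 0]) auto
  moreover have "\<forall>\<^sub>F t in nhds 0. \<gamma> t \<in> E"
    using ev by (rule eventually_mono) (use \<gamma>(2) in blast)
  ultimately have c: "group_curve \<gamma> x (frechet_derivative F (at 0) 1)"
    using \<gamma>(3) unfolding group_curve_def by blast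
  obtain X where X: "X \<in> eucl_lie_algebra" "X \<cdot> x = frechet_derivative F (at 0) 1"
    using c by (rule velocity_mult_inverse_in_lie_algebra)
  have "((\<lambda>t. \<phi> (\<gamma> t \<star> H)) has_vector_derivative velocity \<phi> (x \<star> H) X) (at 0)"
    using c X by (intro velocity_curve [OF assms(1,3)]) simp_all
  then show thesis
    using that X(1) \<gamma>(4) vector_derivative_unique_at by blast
qed

text \<open>Expanding \<open>X \<cdot> y\<close> in the standard basis of the ambient space separates the two dependences of
  \<open>D y (X \<cdot> y)\<close> on \<open>y\<close>.\<close>

lemma continuous_on_velocity:
  assumes "(U, \<phi>) \<in> \<A>" "X \<in> eucl_lie_algebra"
  shows "continuous_on {x \<in> E. x \<star> H \<in> U} (\<lambda>x. velocity \<phi> (x \<star> H) X)" (is "continuous_on ?S _")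
proof (rule continuous_on_local)
  fix x assume "x \<in> ?S"
  then have x: "x \<in> E" "x \<star> H \<in> U" by simp_all
  obtain W D where D: "open W" "x \<in> W" "\<And>y. y \<in> W \<Longrightarrow> linear (D y)"
    "\<And>\<xi>. continuous_on W (\<lambda>y. D y \<xi>)"
    "\<And>y X. y \<in> W \<Longrightarrow> y \<in> E \<Longrightarrow> y \<star> H \<in> U \<Longrightarrow> X \<in> eucl_lie_algebra \<Longrightarrow>
       velocity \<phi> (y \<star> H) X = D y (X \<cdot> y)"
    using velocity_differential [OF assms(1) x] by metis
  have "D y (X \<cdot> y) = (\<Sum>b\<in>Basis. ((X \<cdot> y) \<bullet> b) *\<^sub>R D y b)" if "y \<in> W" for y
  proof -
    have "D y (X \<cdot> y) = D y (\<Sum>b\<in>Basis. ((X \<cdot> y) \<bullet> b) *\<^sub>R b)"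
      by (simp only: euclidean_representation)
    also have "\<dots> = (\<Sum>b\<in>Basis. ((X \<cdot> y) \<bullet> b) *\<^sub>R D y b)"
      by (simp only: linear_sum [OF D(3) [OF that]] linear_scale [OF D(3) [OF that]])
    finally show ?thesis .
  qed
  then have "velocity \<phi> (y \<star> H) X = (\<Sum>b\<in>Basis. ((X \<cdot> y) \<bullet> b) *\<^sub>R D y b)"
    if "y \<in> ?S \<inter> W" for y
    using that D(5) assms(2) by auto
  moreover have "continuous_on (?S \<inter> W) (\<lambda>y. \<Sum>b\<in>Basis. ((X \<cdot> y) \<bullet> b) *\<^sub>R D y b)"
    by (intro continuous_on_sum continuous_on_scaleR continuous_on_inner continuous_on_const
        continuous_on_eucl_mult_left continuous_on_subset [OF D(4)]) simp
  ultimately show "\<exists>W. open W \<and> x \<in> W \<and> continuous_on (?S \<inter> W) (\<lambda>x. velocity \<phi> (x \<star> H) X)"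
    using D(1,2) by (metis (no_types, lifting) continuous_on_cong)
qed

end

section \<open>The invariant bilinear form\<close>

lemma pseudo_euclidean_productD:
  assumes "pseudo_euclidean_product V b"
  shows pseudo_euclidean_product_sym: "u \<in> V \<Longrightarrow> w \<in> V \<Longrightarrow> b u w = b w u"
    and pseudo_euclidean_product_add: "u \<in> V \<Longrightarrow> v \<in> V \<Longrightarrow> w \<in> V \<Longrightarrow> b (u + v) w = b u w + b v w"
    and pseudo_euclidean_product_scaleR: "u \<in> V \<Longrightarrow> w \<in> V \<Longrightarrow> b (r *\<^sub>R u) w = r * b u w"
    and pseudo_euclidean_product_nondegenerate: "u \<in> V \<Longrightarrow> (\<And>w. w \<in> V \<Longrightarrow> b u w = 0) \<Longrightarrow> u = 0"
  using assms unfolding pseudo_euclidean_product_def by blast+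

locale invariant_metric_quotient = euclidean_quotient H V \<A>
  for H :: "((real ^ 'n ^ 'n) \<times> (real ^ 'n)) set" and V \<A> +
  fixes g :: "(((real ^ 'n ^ 'n) \<times> (real ^ 'n)) set, (real ^ 'n ^ 'n) \<times> (real ^ 'n)) metric_field"
  assumes metric: "pseudo_riemannian_metric V \<A> g"
    and isometric: "\<And>a. a \<in> carrier euclidean_group \<Longrightarrow>
      isometry (coset_topology euclidean_group H) V \<A> g (\<lambda>p. a <#\<^bsub>euclidean_group\<^esub> p)"
begin

text \<open>The isometry condition is phrased with directional derivatives of coordinate expressions along
  straight lines; this turns them into fundamental vector fields. Both the line and the curve
  \<open>t \<mapsto> \<phi> (\<gamma> t \<star> H)\<close> have velocity \<open>velocity \<phi> (x \<star> H) X\<close>, so the coordinate expression of the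
  translation has the same derivative along both.\<close>

lemma dir_deriv_translation:
  assumes "(U, \<phi>) \<in> \<A>" "(W, \<psi>) \<in> \<A>" "x \<in> E" "x \<star> H \<in> U"
    and y: "y = (mat 1, u) \<cdot> x" "y \<star> H \<in> W" and X: "X \<in> eucl_lie_algebra"
  shows "dir_deriv (\<psi> \<circ> (\<lambda>p. (mat 1, u) \<star> p) \<circ> inv_into U \<phi>) (\<phi> (x \<star> H)) (velocity \<phi> (x \<star> H) X)
    = velocity \<psi> (y \<star> H) (X \<cdot> (mat 1, - u))"
proof -
  let ?a = "(mat 1, u)" and ?p = "x \<star> H"
  let ?v = "velocity \<phi> ?p X" and ?K = "\<psi> \<circ> (\<lambda>p. (mat 1, u) \<star> p) \<circ> inv_into U \<phi>"
  define S where "S = {p \<in> U. ?a \<star> p \<in> W}"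
  note a = translation_in_carrier [of u]
  have diffeo: "diffeomorphism M \<A> (\<lambda>p. ?a \<star> p)"
    using isometric [OF a] unfolding isometry_def by blast
  have "continuous_map M M (\<lambda>p. ?a \<star> p)"
    using diffeo unfolding diffeomorphism_def by (blast dest: homeomorphic_imp_continuous_map)
  then have "openin M {p \<in> topspace M. ?a \<star> p \<in> W}"
    using chart_open [OF assms(2)] by (simp add: continuous_map)
  moreover have "S = U \<inter> {p \<in> topspace M. ?a \<star> p \<in> W}"
    using openin_subset [OF chart_open [OF assms(1)]] by (auto simp: S_def)
  ultimately have S_open: "openin M S"
    using chart_open [OF assms(1)] by auto
  have K_smooth: "smooth_on (\<phi> ` S) ?K"
    using diffeo assms(1,2) unfolding diffeomorphism_def smooth_self_map_def S_def by blast
  have p: "?p \<in> S"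
    using assms by (simp add: S_def act_coset a)
  obtain N F where F: "open N" "\<phi> ?p \<in> N" "\<And>z. z \<in> N \<Longrightarrow> F differentiable (at z)"
    "\<And>z. z \<in> \<phi> ` S \<Longrightarrow> z \<in> N \<Longrightarrow> F z = ?K z"
    using smooth_on_extension [OF K_smooth imageI [OF p]] by metis
  note chain = has_vector_derivative_extension_compose
    [where A = "\<phi> ` S", OF F(3) [OF F(2)] F(1,2,4)]
  have v: "?v \<in> V"
    using assms by (intro velocity_in_V)
  obtain N' where N': "open N'" "\<phi> ` S = V \<inter> N'"
    using openin_chart_image [OF assms(1) S_open] by (auto simp: S_def openin_open)
  have "((\<lambda>t. ?K (\<phi> ?p + t *\<^sub>R ?v)) has_vector_derivative
      frechet_derivative F (at (\<phi> ?p)) ?v) (at 0)"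
  proof (rule chain)
    have "isCont (\<lambda>t. \<phi> ?p + t *\<^sub>R ?v) 0"
      by (intro continuous_intros)
    then have "\<forall>\<^sub>F t in nhds 0. \<phi> ?p + t *\<^sub>R ?v \<in> N'"
      by (rule isCont_eventually_mem) (use N' p in auto)
    then show "\<forall>\<^sub>F t in nhds 0. \<phi> ?p + t *\<^sub>R ?v \<in> \<phi> ` S"
    proof (rule eventually_mono)
      have "\<phi> ?p \<in> V"
        using N' p by blast
      then have "\<phi> ?p + t *\<^sub>R ?v \<in> V" for t
        using v subspace_V by (simp add: subspace_add subspace_scale)
      then show "\<phi> ?p + t *\<^sub>R ?v \<in> \<phi> ` S" if "\<phi> ?p + t *\<^sub>R ?v \<in> N'" for t
        unfolding N'(2) using that by blast
    qed
  qed (auto intro!: derivative_eq_intros)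
  then have "dir_deriv ?K (\<phi> ?p) ?v = frechet_derivative F (at (\<phi> ?p)) ?v"
    unfolding dir_deriv_def by (rule vector_derivative_at)
  moreover have "velocity \<psi> (y \<star> H) (X \<cdot> (mat 1, - u)) = frechet_derivative F (at (\<phi> ?p)) ?v"
  proof -
    obtain \<gamma> where \<gamma>: "group_curve \<gamma> x (X \<cdot> x)"
      using assms(3) X by (rule velocity_curve_exists)
    have \<gamma>_S: "\<forall>\<^sub>F t in nhds 0. \<gamma> t \<in> {x \<in> E. x \<star> H \<in> S}"
      by (intro group_curve_eventually [OF \<gamma>] openin_preimage S_open) (use assms(3) p in simp)
    have "((\<lambda>t. ?K (\<phi> (\<gamma> t \<star> H))) has_vector_derivative frechet_derivative F (at (\<phi> ?p)) ?v) (at 0)"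
    proof (rule chain)
      show "\<phi> (\<gamma> 0 \<star> H) = \<phi> ?p"
        using \<gamma> by (simp add: group_curve_def)
      show "((\<lambda>t. \<phi> (\<gamma> t \<star> H)) has_vector_derivative ?v) (at 0)"
        by (rule velocity_curve [OF assms(1,4) X \<gamma>])
      show "\<forall>\<^sub>F t in nhds 0. \<phi> (\<gamma> t \<star> H) \<in> \<phi> ` S"
        using \<gamma>_S by (rule eventually_mono) blast
    qed
    moreover have "\<forall>\<^sub>F t in nhds 0. ?K (\<phi> (\<gamma> t \<star> H)) = \<psi> ((?a \<cdot> \<gamma> t) \<star> H)"
      using \<gamma>_S
    proof (rule eventually_mono)
      fix t assume "\<gamma> t \<in> {x \<in> E. x \<star> H \<in> S}"
      then have t: "\<gamma> t \<in> E" "\<gamma> t \<star> H \<in> U"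
        by (simp_all add: S_def)
      then show "?K (\<phi> (\<gamma> t \<star> H)) = \<psi> ((?a \<cdot> \<gamma> t) \<star> H)"
        using chart_inj [OF assms(1)] by (simp add: act_coset a)
    qed
    ultimately have "((\<lambda>t. \<psi> ((?a \<cdot> \<gamma> t) \<star> H)) has_vector_derivative
        frechet_derivative F (at (\<phi> ?p)) ?v) (at 0)"
      by (rule has_vector_derivative_transform_eventually)
    moreover have "((\<lambda>t. \<psi> ((?a \<cdot> \<gamma> t) \<star> H)) has_vector_derivative
        velocity \<psi> (y \<star> H) (X \<cdot> (mat 1, - u))) (at 0)"
    proof (rule velocity_curve [OF assms(2) y(2) conj_translation_in_lie_algebra [OF X]])
      have "(mat 1, - u) \<cdot> (?a \<cdot> x) = x"
        by (simp add: translation_mult zero_prod_def)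
      then have "(X \<cdot> (mat 1, - u)) \<cdot> y = X \<cdot> x"
        by (simp add: y(1) eucl_mult_assoc)
      then show "group_curve (\<lambda>t. ?a \<cdot> \<gamma> t) y ((X \<cdot> (mat 1, - u)) \<cdot> y)"
        using group_curve_translate [OF \<gamma>, of u] y(1) by simp
    qed
    ultimately show ?thesis
      using vector_derivative_unique_at by blast
  qed
  ultimately show ?thesis by simp
qed

lemma metric_translation:
  assumes "(U, \<phi>) \<in> \<A>" "(W, \<psi>) \<in> \<A>" "x \<in> E" "x \<star> H \<in> U"
    and y: "y = (mat 1, u) \<cdot> x" "y \<star> H \<in> W"
    and X: "X \<in> eucl_lie_algebra" and Y: "Y \<in> eucl_lie_algebra"
  shows "g (W, \<psi>) (\<psi> (y \<star> H)) (velocity \<psi> (y \<star> H) (X \<cdot> (mat 1, - u)))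
      (velocity \<psi> (y \<star> H) (Y \<cdot> (mat 1, - u)))
    = g (U, \<phi>) (\<phi> (x \<star> H)) (velocity \<phi> (x \<star> H) X) (velocity \<phi> (x \<star> H) Y)"
proof -
  let ?K = "\<psi> \<circ> (\<lambda>p. (mat 1, u) \<star> p) \<circ> inv_into U \<phi>" and ?p = "x \<star> H"
  note a = translation_in_carrier [of u]
  have ap: "(mat 1, u) \<star> ?p = y \<star> H"
    using assms by (simp add: act_coset a)
  have "\<forall>u'\<in>V. \<forall>w\<in>V. g (W, \<psi>) (\<psi> (y \<star> H)) (dir_deriv ?K (\<phi> ?p) u') (dir_deriv ?K (\<phi> ?p) w)
      = g (U, \<phi>) (\<phi> ?p) u' w"
    using isometric [OF a] assms(1,2,4) y(2) unfolding isometry_def ap [symmetric] by blast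
  from this [rule_format, OF velocity_in_V [OF assms(1,3,4) X] velocity_in_V [OF assms(1,3,4) Y]]
  show ?thesis
    by (simp only: dir_deriv_translation [OF assms(1-6)] X Y)
qed

definition form where
  "form p X Y = (let (U, \<phi>) = (SOME C. C \<in> \<A> \<and> p \<in> fst C)
     in g (U, \<phi>) (\<phi> p) (velocity \<phi> p X) (velocity \<phi> p Y))"

text \<open>Independence of the chart is invariance under the identity, the translation by \<open>0\<close>.\<close>

lemma form_chart:
  assumes "(U, \<phi>) \<in> \<A>" "x \<in> E" "x \<star> H \<in> U" "X \<in> eucl_lie_algebra" "Y \<in> eucl_lie_algebra"
  shows "form (x \<star> H) X Y = g (U, \<phi>) (\<phi> (x \<star> H)) (velocity \<phi> (x \<star> H) X) (velocity \<phi> (x \<star> H) Y)"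
proof -
  obtain W \<psi> where C: "(SOME C. C \<in> \<A> \<and> x \<star> H \<in> fst C) = (W, \<psi>)"
    by fastforce
  have "\<exists>C. C \<in> \<A> \<and> x \<star> H \<in> fst C"
    using assms(1,3) by force
  from someI_ex [OF this] have W: "(W, \<psi>) \<in> \<A>" "x \<star> H \<in> W"
    by (simp_all add: C)
  have "form (x \<star> H) X Y = g (W, \<psi>) (\<psi> (x \<star> H)) (velocity \<psi> (x \<star> H) X) (velocity \<psi> (x \<star> H) Y)"
    by (simp add: form_def C)
  also have "\<dots> = g (U, \<phi>) (\<phi> (x \<star> H)) (velocity \<phi> (x \<star> H) X) (velocity \<phi> (x \<star> H) Y)"
    using metric_translation [OF assms(1) W(1) assms(2,3) _ W(2) assms(4,5), of 0]
    by (simp add: eucl_mult_eq)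
  finally show ?thesis .
qed

lemma point_chart:
  assumes "x \<in> E"
  obtains U \<phi> where "(U, \<phi>) \<in> \<A>" "x \<star> H \<in> U"
  using assms chart_cover [of "x \<star> H"] in_topspace_iff by metis

lemma form_translation:
  assumes "x \<in> E" "X \<in> eucl_lie_algebra" "Y \<in> eucl_lie_algebra"
  shows "form (((mat 1, u) \<cdot> x) \<star> H) X Y = form (x \<star> H) (X \<cdot> (mat 1, u)) (Y \<cdot> (mat 1, u))"
proof -
  let ?y = "(mat 1, u) \<cdot> x"
  have y: "?y \<in> E"
    by (intro eucl.m_closed translation_in_carrier assms(1))
  obtain U \<phi> where U: "(U, \<phi>) \<in> \<A>" "x \<star> H \<in> U"
    using assms(1) by (rule point_chart)
  obtain W \<psi> where W: "(W, \<psi>) \<in> \<A>" "?y \<star> H \<in> W"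
    using y by (rule point_chart)
  have "(X \<cdot> (mat 1, u)) \<cdot> (mat 1, - u) = X" for X :: "(real ^ 'n ^ 'n) \<times> (real ^ 'n)"
    unfolding eucl_mult_assoc by (simp add: eucl_mult_eq)
  then show ?thesis
    using metric_translation [OF U(1) W(1) assms(1) U(2) refl W(2),
        of "X \<cdot> (mat 1, u)" "Y \<cdot> (mat 1, u)"] assms y U W
    by (simp add: form_chart conj_translation_in_lie_algebra)
qed

lemma form_commute:
  assumes "x \<in> E" "X \<in> eucl_lie_algebra" "Y \<in> eucl_lie_algebra"
  shows "form (x \<star> H) X Y = form (x \<star> H) Y X"
proof -
  obtain U \<phi> where U: "(U, \<phi>) \<in> \<A>" "x \<star> H \<in> U"
    using assms(1) by (rule point_chart)
  then have "pseudo_euclidean_product V (g (U, \<phi>) (\<phi> (x \<star> H)))"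
    using metric unfolding pseudo_riemannian_metric_def by blast
  then show ?thesis
    using assms U velocity_in_V [OF U(1) assms(1) U(2)]
    by (simp add: form_chart pseudo_euclidean_product_sym)
qed

lemma form_add_scaleR:
  assumes "x \<in> E" "X \<in> eucl_lie_algebra" "Y \<in> eucl_lie_algebra" "Z \<in> eucl_lie_algebra"
    and "X + r *\<^sub>R Y \<in> eucl_lie_algebra"
  shows "form (x \<star> H) (X + r *\<^sub>R Y) Z = form (x \<star> H) X Z + r * form (x \<star> H) Y Z"
proof -
  obtain U \<phi> where U: "(U, \<phi>) \<in> \<A>" "x \<star> H \<in> U"
    using assms(1) by (rule point_chart)
  then have "pseudo_euclidean_product V (g (U, \<phi>) (\<phi> (x \<star> H)))"
    using metric unfolding pseudo_riemannian_metric_def by blast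
  then show ?thesis
    using assms U velocity_in_V [OF U(1) assms(1) U(2)] subspace_V
    by (simp add: form_chart velocity_add_scaleR pseudo_euclidean_product_add
        pseudo_euclidean_product_scaleR subspace_scale)
qed

text \<open>Smoothness of the metric concerns its values on constant vectors, so both fields are expanded in
  an orthonormal basis of the model space.\<close>

lemma continuous_on_form_chart:
  assumes "(U, \<phi>) \<in> \<A>" "X \<in> eucl_lie_algebra" "Y \<in> eucl_lie_algebra"
  shows "continuous_on {x \<in> E. x \<star> H \<in> U} (\<lambda>x. form (x \<star> H) X Y)" (is "continuous_on ?S _")
proof -
  obtain B where B: "B \<subseteq> V" "pairwise orthogonal B" "\<And>b. b \<in> B \<Longrightarrow> norm b = 1"
    "independent B" "span B = V"
    using orthonormal_basis_subspace [OF subspace_V] by metis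
  have fin: "finite B"
    using B(4) by (rule independent_imp_finite)
  let ?v = "\<lambda>X x. velocity \<phi> (x \<star> H) X"
  have expand_form: "form (x \<star> H) X Y = (\<Sum>b\<in>B. \<Sum>c\<in>B. (?v X x \<bullet> b) * (?v Y x \<bullet> c) * g (U, \<phi>) (\<phi> (x \<star> H)) b c)"
    if x: "x \<in> ?S" for x
  proof -
    let ?g = "g (U, \<phi>) (\<phi> (x \<star> H))"
    have g: "pseudo_euclidean_product V ?g"
      using metric assms(1) x unfolding pseudo_riemannian_metric_def by blast
    have left: "?g (\<Sum>b\<in>A. f b *\<^sub>R b) w = (\<Sum>b\<in>A. f b * ?g b w)"
      if "A \<subseteq> B" "w \<in> V" for A f w
    proof -
      have "finite A" using that(1) fin by (rule finite_subset)
      then show ?thesis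
        using that
      proof (induction A)
        case empty
        have "?g (0 *\<^sub>R w) w = 0 * ?g w w"
          using g empty unfolding pseudo_euclidean_product_def by blast
        then show ?case by simp
      next
        case (insert b A)
        have "(\<Sum>b\<in>A. f b *\<^sub>R b) \<in> V" "b \<in> V"
          using insert.prems B(1) subspace_V by (auto intro!: subspace_sum subspace_scale)
        then show ?case
          using insert g subspace_V
          by (simp add: pseudo_euclidean_product_add pseudo_euclidean_product_scaleR subspace_scale)
      qed
    qed
    have expand: "v = (\<Sum>b\<in>B. (v \<bullet> b) *\<^sub>R b)" if "v \<in> V" for v
      using that by (intro orthonormal_basis_expand [OF B(2,3) _ fin, symmetric]) (simp_all add: B(5))
    have v: "?v X x \<in> V" "?v Y x \<in> V"
      using velocity_in_V [OF assms(1)] x assms(2,3) by auto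
    have "form (x \<star> H) X Y = ?g (?v X x) (?v Y x)"
      using x assms by (simp add: form_chart)
    also have "\<dots> = (\<Sum>b\<in>B. (?v X x \<bullet> b) * ?g b (?v Y x))"
      by (subst (1) expand [OF v(1)]) (rule left [OF order_refl v(2)])
    also have "\<dots> = (\<Sum>b\<in>B. (?v X x \<bullet> b) * (\<Sum>c\<in>B. (?v Y x \<bullet> c) * ?g b c))"
    proof (intro sum.cong refl arg_cong2 [where f = "(*)"])
      fix b assume "b \<in> B"
      then have b: "b \<in> V" using B(1) by blast
      have sym: "\<And>u w. u \<in> V \<Longrightarrow> w \<in> V \<Longrightarrow> ?g u w = ?g w u"
        using g unfolding pseudo_euclidean_product_def by blast
      have "?g b (?v Y x) = ?g (?v Y x) b"
        by (rule sym [OF b v(2)])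
      also have "\<dots> = (\<Sum>c\<in>B. (?v Y x \<bullet> c) * ?g c b)"
        by (subst (1) expand [OF v(2)]) (rule left [OF order_refl b])
      also have "\<dots> = (\<Sum>c\<in>B. (?v Y x \<bullet> c) * ?g b c)"
        using B(1) b by (intro sum.cong refl) (simp add: sym subsetD)
      finally show "?g b (?v Y x) = (\<Sum>c\<in>B. (?v Y x \<bullet> c) * ?g b c)" .
    qed
    finally show ?thesis
      by (simp add: sum_distrib_left mult.assoc)
  qed
  have "continuous_on ?S (\<lambda>x. \<Sum>b\<in>B. \<Sum>c\<in>B.
      (?v X x \<bullet> b) * (?v Y x \<bullet> c) * g (U, \<phi>) (\<phi> (x \<star> H)) b c)"
  proof (rule continuous_on_sum)
    fix b assume b: "b \<in> B"
    show "continuous_on ?S (\<lambda>x. \<Sum>c\<in>B.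
        (?v X x \<bullet> b) * (?v Y x \<bullet> c) * g (U, \<phi>) (\<phi> (x \<star> H)) b c)"
    proof (rule continuous_on_sum)
      fix c assume "c \<in> B"
      with b have bc: "b \<in> V" "c \<in> V"
        using B(1) by auto
      have "\<forall>u\<in>V. \<forall>w\<in>V. smooth_on (\<phi> ` U) (\<lambda>z. g (U, \<phi>) z u w)"
        using metric assms(1) unfolding pseudo_riemannian_metric_def by blast
      from this [rule_format, OF bc] have "smooth_on (\<phi> ` U) (\<lambda>z. g (U, \<phi>) z b c)" .
      then have g: "continuous_on (\<phi> ` U) (\<lambda>z. g (U, \<phi>) z b c)"
        by (rule smooth_on_imp_continuous_on)
      have "continuous_on ?S (\<lambda>x. g (U, \<phi>) (\<phi> (x \<star> H)) b c)"
        by (rule continuous_on_compose2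
            [OF g smooth_on_imp_continuous_on [OF chart_smooth [OF assms(1)]]]) auto
      from continuous_on_mult [OF continuous_on_mult [OF
          continuous_on_inner [OF continuous_on_velocity [OF assms(1,2)] continuous_on_const]
          continuous_on_inner [OF continuous_on_velocity [OF assms(1,3)] continuous_on_const]] this]
      show "continuous_on ?S (\<lambda>x. (?v X x \<bullet> b) * (?v Y x \<bullet> c) * g (U, \<phi>) (\<phi> (x \<star> H)) b c)" .
    qed
  qed
  then show ?thesis
    by (rule continuous_on_cong [THEN iffD2, OF refl expand_form, rotated])
qed

text \<open>The only use of compactness: the form is a continuous function on the quotient.\<close>

lemma form_bounded:
  assumes "compact_space M" "X \<in> eucl_lie_algebra" "Y \<in> eucl_lie_algebra"
  obtains C where "\<And>x. x \<in> E \<Longrightarrow> \<bar>form (x \<star> H) X Y\<bar> \<le> C"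
proof -
  have cont: "continuous_on E (\<lambda>x. form (x \<star> H) X Y)"
  proof (rule continuous_on_local)
    fix x assume x: "x \<in> E"
    obtain U \<phi> where U: "(U, \<phi>) \<in> \<A>" "x \<star> H \<in> U"
      using x by (rule point_chart)
    obtain W where W: "open W" "{x \<in> E. x \<star> H \<in> U} = E \<inter> W"
      using openin_preimage [OF chart_open [OF U(1)]] by (auto simp: openin_open)
    then show "\<exists>W. open W \<and> x \<in> W \<and> continuous_on (E \<inter> W) (\<lambda>x. form (x \<star> H) X Y)"
      using continuous_on_form_chart [OF U(1) assms(2,3)] x U(2) by auto
  qed
  have "continuous_map M euclidean (\<lambda>p. form p X Y)"
    unfolding continuous_map
  proof (intro conjI allI impI)
    fix T :: "real set" assume "openin euclidean T"
    then have "openin (top_of_set E) (E \<inter> (\<lambda>x. form (x \<star> H) X Y) -` T)"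
      using cont by (intro continuous_openin_preimage_gen) simp_all
    moreover have "{x \<in> E. x \<star> H \<in> {p \<in> topspace M. form p X Y \<in> T}} = E \<inter> (\<lambda>x. form (x \<star> H) X Y) -` T"
      using in_topspace_iff by auto
    ultimately show "openin M {p \<in> topspace M. form p X Y \<in> T}"
      by (simp add: openin_coset_topology topspace_coset_topology)
  qed simp
  then have "compactin euclidean ((\<lambda>p. form p X Y) ` topspace M)"
    using assms(1) image_compactin unfolding compact_space_def by blast
  then have "bounded ((\<lambda>p. form p X Y) ` topspace M)"
    by (simp add: compact_imp_bounded)
  then obtain C where "\<And>p. p \<in> topspace M \<Longrightarrow> norm (form p X Y) \<le> C"
    unfolding bounded_iff by auto
  then show thesis
    using that in_topspace_iff by (metis real_norm_def)
qed

end

section \<open>Translations are isotropic and act trivially\<close>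

lemma bounded_quadratic_linear_coeff:
  fixes a b c :: real
  assumes "\<And>t. \<bar>a + t * b + t\<^sup>2 * c\<bar> \<le> C"
  shows "b = 0"
proof (rule ccontr)
  assume b: "b \<noteq> 0"
  \<comment> \<open>The values at \<open>?t\<close> and \<open>- ?t\<close> differ by \<open>2 * (C + 1)\<close>, but both lie in an interval of
    length \<open>2 * C\<close>.\<close>
  let ?t = "(C + 1) / b"
  have "\<bar>a + ?t * b + ?t\<^sup>2 * c\<bar> \<le> C" "\<bar>a + (- ?t) * b + (- ?t)\<^sup>2 * c\<bar> \<le> C"
    by (rule assms)+
  moreover have "?t * b = C + 1" "(- ?t) * b = - (C + 1)"
    using b by simp_all
  ultimately show False
    unfolding power2_minus by linarith
qed

context invariant_metric_quotient
begin

lemma form_zero_left: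
  assumes "x \<in> E" "Y \<in> eucl_lie_algebra"
  shows "form (x \<star> H) (0, 0) Y = 0"
  using form_add_scaleR [of x "(0, 0)" "(0, 0)" Y 1] assms translation_in_lie_algebra [of 0] by simp

text \<open>Invariance under the translation by \<open>t v\<close> moves the base point from \<open>x\<close> to another point of the group
  and replaces \<open>X = (A, w)\<close> by \<open>(A, w + t A v)\<close>. As this is affine in \<open>t\<close>, the value of the form at
  the moved point is a polynomial in \<open>t\<close> of degree at most \<open>2\<close>. It is bounded, so its linear
  coefficient vanishes.\<close>

lemma form_translation_skew:
  assumes "compact_space M" "x \<in> E" "X \<in> eucl_lie_algebra" "Y \<in> eucl_lie_algebra"
  shows "form (x \<star> H) (0, fst X *v v) Y = - form (x \<star> H) (0, fst Y *v v) X"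
proof -
  obtain C where C: "\<And>x. x \<in> E \<Longrightarrow> \<bar>form (x \<star> H) X Y\<bar> \<le> C"
    using form_bounded [OF assms(1,3,4)] by blast
  let ?X = "(0, fst X *v v)" and ?Y = "(0, fst Y *v v)"
  let ?F = "form (x \<star> H)"
  note T = translation_in_lie_algebra
  have conj: "Z \<cdot> (mat 1, t *\<^sub>R v) = Z + t *\<^sub>R (0, fst Z *v v)"
    for Z :: "(real ^ 'n ^ 'n) \<times> (real ^ 'n)" and t
    by (simp add: eucl_mult_eq prod_eq_iff matrix_vector_mult_scaleR)
  have "\<bar>?F X Y + t * (?F ?X Y + ?F ?Y X) + t\<^sup>2 * ?F ?X ?Y\<bar> \<le> C" for t
  proof -
    have Xt: "X + t *\<^sub>R ?X \<in> eucl_lie_algebra" and Yt: "Y + t *\<^sub>R ?Y \<in> eucl_lie_algebra"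
      using conj_translation_in_lie_algebra assms(3,4) by (metis conj)+
    have right: "?F Z (Y + t *\<^sub>R ?Y) = ?F Z Y + t * ?F ?Y Z" if Z: "Z \<in> eucl_lie_algebra" for Z
      using form_add_scaleR [OF assms(2,4) T Z Yt] form_commute [OF assms(2) Z Yt]
        form_commute [OF assms(2) Z assms(4)] by simp
    have "?F (X + t *\<^sub>R ?X) (Y + t *\<^sub>R ?Y) = ?F X (Y + t *\<^sub>R ?Y) + t * ?F ?X (Y + t *\<^sub>R ?Y)"
      by (rule form_add_scaleR [OF assms(2,3) T Yt Xt])
    also have "\<dots> = ?F X Y + t * (?F ?X Y + ?F ?Y X) + t\<^sup>2 * ?F ?X ?Y"
      unfolding right [OF assms(3)] right [OF T] form_commute [OF assms(2) T T, of "fst Y *v v"]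
      by (simp add: algebra_simps power2_eq_square)
    finally have "form (((mat 1, t *\<^sub>R v) \<cdot> x) \<star> H) X Y
        = ?F X Y + t * (?F ?X Y + ?F ?Y X) + t\<^sup>2 * ?F ?X ?Y"
      using form_translation [OF assms(2-4)] by (simp add: conj)
    moreover have "\<bar>form (((mat 1, t *\<^sub>R v) \<cdot> x) \<star> H) X Y\<bar> \<le> C"
      by (intro C eucl.m_closed translation_in_carrier assms(2))
    ultimately show ?thesis by simp
  qed
  then have "?F ?X Y + ?F ?Y X = 0"
    by (rule bounded_quadratic_linear_coeff)
  then show ?thesis by simp
qed

lemma linear_form_translation:
  assumes "x \<in> E" "Y \<in> eucl_lie_algebra"
  shows "linear (\<lambda>v. form (x \<star> H) (0, v) Y)"
proof (rule linearI)
  note T = translation_in_lie_algebra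
  fix v w :: "real ^ 'n" and r :: real
  show "form (x \<star> H) (0, v + w) Y = form (x \<star> H) (0, v) Y + form (x \<star> H) (0, w) Y"
    using form_add_scaleR [OF assms(1) T T assms(2), of v 1 w] T [of "v + w"] by simp
  show "form (x \<star> H) (0, r *\<^sub>R v) Y = r *\<^sub>R form (x \<star> H) (0, v) Y"
    using form_add_scaleR [OF assms(1) T T assms(2), of 0 r v] T [of "r *\<^sub>R v"] form_zero_left [OF assms] by simp
qed

lemma form_translation_eq_0I:
  assumes "x \<in> E" "Y \<in> eucl_lie_algebra" "\<And>k. form (x \<star> H) (0, axis k 1) Y = 0"
  shows "form (x \<star> H) (0, v) Y = 0"
proof -
  have "(\<lambda>v. form (x \<star> H) (0, v) Y) = (\<lambda>v. 0)"
    by (rule linear_eq_stdbasis [OF linear_form_translation [OF assms(1,2)] linear_zero])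
      (auto simp: Basis_vec_def assms(3))
  then show ?thesis by metis
qed

text \<open>Write \<open>\<lambda>\<^sub>X v\<close> for the form on \<open>(0, v)\<close> and \<open>X\<close>, and \<open>A\<^sub>X\<close> for the linear part of \<open>X\<close>. The
  relation \<open>\<lambda>\<^sub>Y (A\<^sub>X v) = - \<lambda>\<^sub>X (A\<^sub>Y v)\<close> is the only input. For a rotation generator
  \<open>E\<^sub>i\<^sub>j\<close> it gives \<open>\<lambda> = 0\<close> on \<open>e\<^sub>i\<close> and \<open>e\<^sub>j\<close> (take \<open>X = Y\<close>). On a third axis \<open>e\<^sub>k\<close>
  a fourth index \<open>l\<close> is used: \<open>e\<^sub>k = E\<^sub>k\<^sub>l e\<^sub>l\<close> while \<open>E\<^sub>i\<^sub>j e\<^sub>l = 0\<close>. In dimension \<open>3\<close> there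
  is a third axis but no fourth index, and the cross product gives a nonzero solution. Any other \<open>Y\<close> is
  then compared with \<open>E\<^sub>i\<^sub>j\<close>, where a second axis is needed.\<close>

lemma form_translation_eq_0:
  assumes card: "CARD('n) \<noteq> 1" "CARD('n) \<noteq> 3"
    and cpt: "compact_space M" and x: "x \<in> E" and Y: "Y \<in> eucl_lie_algebra"
  shows "form (x \<star> H) (0, v) Y = 0"
proof -
  let ?F = "form (x \<star> H)" and ?R = "\<lambda>i j. (rotation_generator i j :: real ^ 'n ^ 'n, 0 :: real ^ 'n)"
  note skew = form_translation_skew [OF cpt x]
  note R = rotation_generator_in_lie_algebra
  have R_axis: "?F (0, axis k 1) (?R i j) = 0" if "i \<noteq> j" for i j k :: 'n
  proof -
    consider "k = i" | "k = j" | "k \<noteq> i" "k \<noteq> j" by blast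
    then show ?thesis
    proof cases
      case 1
      have "rotation_generator i j *v axis j 1 = axis i 1"
        using that by (simp add: rotation_generator_mult axis_def)
      then show ?thesis
        using skew [OF R [OF that] R [OF that], of "axis j 1"] 1 by simp
    next
      case 2
      have "rotation_generator i j *v (- axis i 1) = axis j 1"
        using that by (simp add: rotation_generator_mult axis_def)
      then show ?thesis
        using skew [OF R [OF that] R [OF that], of "- axis i 1"] 2 by simp
    next
      case 3
      have "card {i, j, k} = 3"
        using that 3 by simp
      then have "{i, j, k} \<noteq> UNIV"
        using card(2) by metis
      then obtain l where l: "l \<noteq> i" "l \<noteq> j" "k \<noteq> l"
        by auto
      have "rotation_generator k l *v axis l 1 = axis k 1" "rotation_generator i j *v axis l 1 = 0"
        using l 3 by (simp_all add: rotation_generator_mult axis_def)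
      then show ?thesis
        using skew [OF R [OF l(3)] R [OF that], of "axis l 1"] form_zero_left [OF x R [OF l(3)]] by simp
    qed
  qed
  show ?thesis
  proof (rule form_translation_eq_0I [OF x Y])
    fix i :: 'n
    have "card {i} = 1" by simp
    then have "{i} \<noteq> UNIV"
      using card(1) by metis
    then obtain j where j: "i \<noteq> j"
      unfolding set_eq_iff by (auto dest: not_sym)
    have "rotation_generator i j *v axis j 1 = axis i 1"
      using j by (simp add: rotation_generator_mult axis_def)
    then have "?F (0, axis i 1) Y = - ?F (0, fst Y *v axis j 1) (?R i j)"
      using skew [OF R [OF j] Y, of "axis j 1"] by simp
    also have "\<dots> = 0"
      using form_translation_eq_0I [OF x R [OF j] R_axis [OF j]] by simp
    finally show "?F (0, axis i 1) Y = 0" .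
  qed
qed

lemma velocity_translation_eq_0:
  assumes "CARD('n) \<noteq> 1" "CARD('n) \<noteq> 3" "compact_space M"
    and U: "(U, \<phi>) \<in> \<A>" and x: "x \<in> E" "x \<star> H \<in> U"
  shows "velocity \<phi> (x \<star> H) (0, v) = 0"
proof -
  note T = translation_in_lie_algebra
  have "\<forall>p\<in>U. pseudo_euclidean_product V (g (U, \<phi>) (\<phi> p))"
    using metric U unfolding pseudo_riemannian_metric_def by blast
  with x(2) have "pseudo_euclidean_product V (g (U, \<phi>) (\<phi> (x \<star> H)))"
    by blast
  then show ?thesis
  proof (rule pseudo_euclidean_product_nondegenerate)
    show "velocity \<phi> (x \<star> H) (0, v) \<in> V"
      by (rule velocity_in_V [OF U x T])
    fix w assume "w \<in> V"
    then obtain X where "X \<in> eucl_lie_algebra" "velocity \<phi> (x \<star> H) X = w"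
      by (rule velocity_onto [OF U x])
    then show "g (U, \<phi>) (\<phi> (x \<star> H)) (velocity \<phi> (x \<star> H) (0, v)) w = 0"
      using form_chart [OF U x T] form_translation_eq_0 [OF assms(1-3) x(1)] by metis
  qed
qed

text \<open>A translation field vanishes at every coset, so in a chart the orbit has zero velocity at
  every time.\<close>

lemma translation_orbit_locally_constant:
  assumes "CARD('n) \<noteq> 1" "CARD('n) \<noteq> 3" "compact_space M"
  shows "\<forall>\<^sub>F t in at s. (mat 1, s *\<^sub>R v) \<star> H = (mat 1, t *\<^sub>R v) \<star> H"
proof -
  let ?c = "\<lambda>t. (mat 1, t *\<^sub>R v) :: (real ^ 'n ^ 'n) \<times> (real ^ 'n)"
  obtain U \<phi> where U: "(U, \<phi>) \<in> \<A>" "?c s \<star> H \<in> U"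
    using translation_in_carrier by (rule point_chart)
  obtain W where W: "open W" "{x \<in> E. x \<star> H \<in> U} = E \<inter> W"
    using openin_preimage [OF chart_open [OF U(1)]] by (auto simp: openin_open)
  have c_iff: "?c t \<star> H \<in> U \<longleftrightarrow> ?c t \<in> W" for t
    using W(2) translation_in_carrier by blast
  have "isCont ?c s"
    by (intro continuous_intros)
  moreover have "?c s \<in> W"
    using U(2) c_iff by blast
  ultimately have "\<forall>\<^sub>F t in nhds s. ?c t \<in> W"
    using W(1) isCont_eventually_mem by blast
  then obtain e where e: "e > 0" "\<And>t. t \<in> ball s e \<Longrightarrow> ?c t \<star> H \<in> U"
    unfolding eventually_nhds_metric c_iff by (auto simp: dist_commute)
  have deriv: "((\<lambda>t. \<phi> (?c t \<star> H)) has_vector_derivative 0) (at t)" if t: "t \<in> ball s e" for t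
  proof -
    have "group_curve (\<lambda>h. ?c h \<cdot> ?c t) (?c t) ((0, v) \<cdot> ?c t)"
      using group_curve_mult_right [OF group_curve_translations translation_in_carrier, of v "t *\<^sub>R v"]
      by (simp add: translation_in_carrier)
    from velocity_curve [OF U(1) e(2) [OF t] translation_in_lie_algebra this]
    have "((\<lambda>h. \<phi> ((?c h \<cdot> ?c t) \<star> H)) has_vector_derivative 0) (at 0)"
      using velocity_translation_eq_0 [OF assms U(1) translation_in_carrier e(2) [OF t]] by simp
    then have "((\<lambda>h. \<phi> (?c (h + t) \<star> H)) has_vector_derivative 0) (at (t - t))"
      by (simp add: eucl_mult_eq scaleR_add_left)
    moreover have "((\<lambda>r. r - t) has_vector_derivative 1) (at t)"
      by (auto intro!: derivative_eq_intros)
    ultimately have "((\<lambda>h. \<phi> (?c (h + t) \<star> H)) \<circ> (\<lambda>r. r - t) has_vector_derivative 1 *\<^sub>R 0) (at t)"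
      by (intro vector_diff_chain_at)
    then show ?thesis by (simp add: o_def)
  qed
  have const: "?c s \<star> H = ?c t \<star> H" if t: "t \<in> ball s e" for t
  proof -
    have s: "s \<in> ball s e" using e(1) by simp
    obtain k where "\<And>t. t \<in> ball s e \<Longrightarrow> \<phi> (?c t \<star> H) = k"
      using has_vector_derivative_zero_constant [OF convex_ball has_vector_derivative_at_within [OF deriv]]
      by blast
    then have "\<phi> (?c s \<star> H) = \<phi> (?c t \<star> H)"
      using s t by metis
    then show ?thesis
      using chart_inj [OF U(1)] e(2) s t by (meson inj_onD)
  qed
  then show ?thesis
    unfolding eventually_at using e(1) by (auto simp: dist_commute)
qed

lemma translation_fixes_base_point:
  assumes "CARD('n) \<noteq> 1" "CARD('n) \<noteq> 3" "compact_space M"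
  shows "(mat 1, v) \<star> H = H"
proof -
  have "(mat 1, 1 *\<^sub>R v) \<star> H = (mat 1, 0 *\<^sub>R v) \<star> H"
    by (rule connected_local_const [of UNIV "1::real" 0 "\<lambda>t. (mat 1, t *\<^sub>R v) \<star> H"])
      (use translation_orbit_locally_constant [OF assms] in auto)
  moreover have "(mat 1, 0) \<star> H = H"
    using eucl.lcos_mult_one [OF subgroup.subset [OF subgroup_H]] by (simp add: eucl_one_eq)
  ultimately show ?thesis by simp
qed

end

lemma translations_normal:
  "{mat 1} \<times> UNIV \<lhd> (euclidean_group :: ((real ^ 'n ^ 'n) \<times> (real ^ 'n)) monoid)"
proof -
  interpret group "euclidean_group :: ((real ^ 'n ^ 'n) \<times> (real ^ 'n)) monoid"
    by (rule group_euclidean_group)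
  let ?N = "{mat 1} \<times> UNIV :: ((real ^ 'n ^ 'n) \<times> (real ^ 'n)) set"
  have inv: "fst x ** fst (inv\<^bsub>euclidean_group\<^esub> x) = mat 1"
    if "x \<in> carrier euclidean_group" for x :: "(real ^ 'n ^ 'n) \<times> (real ^ 'n)"
    using r_inv [OF that] by (simp add: eucl_mult_eq eucl_one_eq)
  have "subgroup ?N euclidean_group"
  proof (rule subgroupI)
    show "?N \<subseteq> carrier euclidean_group"
      by (auto simp: translation_in_carrier)
    then show "inv\<^bsub>euclidean_group\<^esub> a \<in> ?N" if "a \<in> ?N" for a
      using inv [of a] that by (auto simp: mem_Times_iff)
    show "a \<cdot> b \<in> ?N" if "a \<in> ?N" "b \<in> ?N" for a b
      using that by (auto simp: eucl_mult_eq)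
  qed auto
  moreover have "x \<cdot> h \<cdot> inv\<^bsub>euclidean_group\<^esub> x \<in> ?N"
    if "x \<in> carrier euclidean_group" "h \<in> ?N" for x h
    using that inv [of x] by (simp add: eucl_mult_eq mem_Times_iff)
  ultimately show ?thesis
    unfolding normal_inv_iff by blast
qed

theorem theoremD:
  assumes "CARD('n) \<noteq> 1" and "CARD('n) \<noteq> 3"
  shows "\<not> (\<exists>H :: ((real ^ 'n ^ 'n) \<times> (real ^ 'n)) set.
           subgroup H euclidean_group \<and>
           closedin (top_of_set (carrier euclidean_group)) H \<and>
           compact_space (coset_topology euclidean_group H) \<and>
           almost_effective euclidean_group H \<and>
           carries_invariant_pseudo_riemannian_metric euclidean_group H)"
proof (rule notI, elim exE conjE)
  fix H :: "((real ^ 'n ^ 'n) \<times> (real ^ 'n)) set"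
  assume H: "subgroup H euclidean_group"
    and cpt: "compact_space (coset_topology euclidean_group H)"
    and eff: "almost_effective euclidean_group H"
    and "carries_invariant_pseudo_riemannian_metric euclidean_group H"
  then obtain V \<A> g where "homogeneous_smooth_structure euclidean_group H V \<A>"
    and "pseudo_riemannian_metric V \<A> g"
    and "\<forall>a\<in>carrier euclidean_group.
      isometry (coset_topology euclidean_group H) V \<A> g (\<lambda>p. a <#\<^bsub>euclidean_group\<^esub> p)"
    unfolding carries_invariant_pseudo_riemannian_metric_def by blast
  with H interpret invariant_metric_quotient H V \<A> g
    by (simp add: invariant_metric_quotient_def invariant_metric_quotient_axioms_def euclidean_quotient_def)
  let ?N = "{mat 1} \<times> UNIV :: ((real ^ 'n ^ 'n) \<times> (real ^ 'n)) set"
  have "H = \<one>\<^bsub>euclidean_group\<^esub> <#\<^bsub>euclidean_group\<^esub> H"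
    using eucl.lcos_mult_one [OF subgroup.subset [OF H]] by simp
  then have "H \<in> lcosets\<^bsub>euclidean_group\<^esub> H"
    unfolding LCOSETS_def using eucl.one_closed by blast
  moreover have "?N \<subseteq> stabilizer euclidean_group (\<lambda>a q. a <#\<^bsub>euclidean_group\<^esub> q) H"
    using translation_fixes_base_point [OF assms cpt]
    by (auto simp: stabilizer_def translation_in_carrier)
  moreover have "connected ?N"
    by (intro connected_Times) auto
  ultimately have "?N = {\<one>\<^bsub>euclidean_group\<^esub>}"
    using eff translations_normal unfolding almost_effective_def by blast
  \<comment> \<open>The all-ones vector is a nonzero translation.\<close>
  then have "(mat 1 :: real ^ 'n ^ 'n, 1 :: real ^ 'n) = (mat 1, 0)"
    by (auto simp: eucl_one_eq)
  then show False by simp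
qed

end
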